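(* Let $J\colon\mathcal{C}\to\mathcal{D}$ and $G\colon\mathcal{E}\to\mathcal{D}$ be pseudofunctors between bicategories and let $F$ be a relative left pseudoadjoint to $G$ over $J$. Then the function sending $X\in\mathcal{C}$ to $GF(X)\in\mathcal{D}$ admits the structure of a relative pseudomonad over $J$.
   Context: Associativity and unit isomorphisms of bicategories are suppressed; "$\cdot$" is vertical composition of 2-cells, juxtaposition is composition of morphisms and whiskering. Relative left pseudoadjoint. Let $J\colon\mathcal{C}\to\mathcal{D}$, $G\colon\mathcal{E}\to\mathcal{D}$ be pseudofunctors. A relative left pseudoadjoint $F$ to $G$ over $J$ (a relative pseudoadjunction) consists of: an object $FX\in\mathcal{E}$ for every $X\in\mathcal{C}$; a morphism $i_X\colon JX\to GFX$ in $\mathcal{D}$ for every $X\in\mathcal{C}$; and, for every $X\in\mathcal{C}$, $A\in\mathcal{E}$, an adjoint equivalence whose right adjoint is $G(-)\,i_X\colon\mathcal{E}[FX,A]\to\mathcal{D}[JX,GA]$ and whose left adjoint is denoted $(-)^\sharp\colon\mathcal{D}[JX,GA]\to\mathcal{E}[FX,A]$. Relative pseudomonad. A relative pseudomonad $T$ over $J\colon\mathcal{C}\to\mathcal{D}$ consists of: an object $TX\in\mathcal{D}$ for each $X\in\mathcal{C}$; functors $(-)^*\colon\mathcal{D}[JX,TY]\to\mathcal{D}[TX,TY]$ for $X,Y\in\mathcal{C}$; morphisms $i_X\colon JX\to TX$; invertible 2-cells $\mu_{g,f}\colon(g^*f)^*\to g^*f^*$, natural in $f\colon JX\to TY$, $g\colon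 JY\to TZ$; invertible 2-cells $\eta_f\colon f\to f^*i_X$, natural in $f\colon JX\to TY$; invertible 2-cells $\theta_X\colon (i_X)^*\to 1_{TX}$; such that (associativity) for $f\colon JX\to TY$, $g\colon JY\to TZ$, $h\colon JZ\to TV$: $(h^*\mu_{g,f})\cdot\mu_{h,g^*f}\cdot(\mu_{h,g}f)^*=(\mu_{h,g}f^* )\cdot\mu_{h^*g,f}$ as 2-cells $((h^*g)^*f)^*\to h^*g^*f^*$; (unit) for $f\colon JX\to TY$: $(f^*\theta_X)\cdot\mu_{f,i_X}\cdot(\eta_f)^*=1_{f^*}$. *)

theory Defs
  imports Main
begin

section \<open>Categories, functors and adjoint equivalences\<close>

text \<open>Operations are total functions; their values outside the carriers are unconstrained.\<close>

record ('o, 'a) cat =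
  Ob  :: "'o set"
  Ar  :: "'a set"
  Dom :: "'a \<Rightarrow> 'o"
  Cod :: "'a \<Rightarrow> 'o"
  Cmp :: "'a \<Rightarrow> 'a \<Rightarrow> 'a"  (infixr "\<bullet>\<index>" 70)
  Idn :: "'o \<Rightarrow> 'a"

definition Arr :: "('o, 'a) cat \<Rightarrow> 'o \<Rightarrow> 'o \<Rightarrow> 'a set" where
  "Arr A x y = {u \<in> Ar A. Dom A u = x \<and> Cod A u = y}"

locale category =
  fixes A :: "('o, 'a) cat" (structure)
  assumes Dom_closed: "u \<in> Ar A \<Longrightarrow> Dom A u \<in> Ob A"
    and Cod_closed: "u \<in> Ar A \<Longrightarrow> Cod A u \<in> Ob A"
    and Idn_closed: "x \<in> Ob A \<Longrightarrow> Idn A x \<in> Arr A x x"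
    and Cmp_closed: "\<lbrakk>v \<in> Arr A y z; u \<in> Arr A x y\<rbrakk> \<Longrightarrow> v \<bullet> u \<in> Arr A x z"
    and Cmp_Idn_left: "u \<in> Arr A x y \<Longrightarrow> Idn A y \<bullet> u = u"
    and Cmp_Idn_right: "u \<in> Arr A x y \<Longrightarrow> u \<bullet> Idn A x = u"
    and Cmp_assoc: "\<lbrakk>w \<in> Arr A y z; v \<in> Arr A x y; u \<in> Arr A t x\<rbrakk>
      \<Longrightarrow> (w \<bullet> v) \<bullet> u = w \<bullet> (v \<bullet> u)"

definition is_iso :: "('o, 'a) cat \<Rightarrow> 'a \<Rightarrow> bool" where
  "is_iso A u \<longleftrightarrow> u \<in> Ar A \<and> (\<exists>v \<in> Arr A (Cod A u) (Dom A u).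
      v \<bullet>\<^bsub>A\<^esub> u = Idn A (Dom A u) \<and> u \<bullet>\<^bsub>A\<^esub> v = Idn A (Cod A u))"

record ('o, 'a, 'p, 'b) fctr =
  on_ob :: "'o \<Rightarrow> 'p"
  on_ar :: "'a \<Rightarrow> 'b"

locale cat_functor = A: category A + B: category B
  for A :: "('o, 'a) cat" and B :: "('p, 'b) cat" +
  fixes F :: "('o, 'a, 'p, 'b) fctr"
  assumes on_ob_closed: "x \<in> Ob A \<Longrightarrow> on_ob F x \<in> Ob B"
    and on_ar_closed: "u \<in> Arr A x y \<Longrightarrow> on_ar F u \<in> Arr B (on_ob F x) (on_ob F y)"
    and on_ar_Idn: "x \<in> Ob A \<Longrightarrow> on_ar F (Idn A x) = Idn B (on_ob F x)"
    and on_ar_Cmp: "\<lbrakk>v \<in> Arr A y z; u \<in> Arr A x y\<rbrakk>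
      \<Longrightarrow> on_ar F (v \<bullet>\<^bsub>A\<^esub> u) = on_ar F v \<bullet>\<^bsub>B\<^esub> on_ar F u"

definition id_fctr :: "('o, 'a, 'o, 'a) fctr" where
  "id_fctr = \<lparr>on_ob = (\<lambda>x. x), on_ar = (\<lambda>u. u)\<rparr>"

definition comp_fctr ::
    "('p, 'b, 'q, 'c) fctr \<Rightarrow> ('o, 'a, 'p, 'b) fctr \<Rightarrow> ('o, 'a, 'q, 'c) fctr" where
  "comp_fctr G F = \<lparr>on_ob = (\<lambda>x. on_ob G (on_ob F x)), on_ar = (\<lambda>u. on_ar G (on_ar F u))\<rparr>"

locale natural_transformation = F: cat_functor A B F + G: cat_functor A B G
  for A :: "('o, 'a) cat" and B :: "('p, 'b) cat"
    and F G :: "('o, 'a, 'p, 'b) fctr" +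
  fixes \<tau> :: "'o \<Rightarrow> 'b"
  assumes component: "x \<in> Ob A \<Longrightarrow> \<tau> x \<in> Arr B (on_ob F x) (on_ob G x)"
    and naturality: "u \<in> Arr A x y \<Longrightarrow> on_ar G u \<bullet>\<^bsub>B\<^esub> \<tau> x = \<tau> y \<bullet>\<^bsub>B\<^esub> on_ar F u"

text \<open>\<open>L : A \<rightarrow> B\<close> is the left and \<open>R : B \<rightarrow> A\<close> the right adjoint.\<close>

locale adjunction =
  L: cat_functor A B L + R: cat_functor B A R +
  unit: natural_transformation A A id_fctr "comp_fctr R L" \<eta> +
  counit: natural_transformation B B "comp_fctr L R" id_fctr \<epsilon>
  for A :: "('o, 'a) cat" and B :: "('p, 'b) cat"
    and L :: "('o, 'a, 'p, 'b) fctr" and R :: "('p, 'b, 'o, 'a) fctr"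
    and \<eta> :: "'o \<Rightarrow> 'a" and \<epsilon> :: "'p \<Rightarrow> 'b" +
  assumes triangle_left: "x \<in> Ob A
      \<Longrightarrow> \<epsilon> (on_ob L x) \<bullet>\<^bsub>B\<^esub> on_ar L (\<eta> x) = Idn B (on_ob L x)"
    and triangle_right: "y \<in> Ob B
      \<Longrightarrow> on_ar R (\<epsilon> y) \<bullet>\<^bsub>A\<^esub> \<eta> (on_ob R y) = Idn A (on_ob R y)"

locale adjoint_equivalence = adjunction +
  assumes unit_iso: "x \<in> Ob A \<Longrightarrow> is_iso A (\<eta> x)"
    and counit_iso: "y \<in> Ob B \<Longrightarrow> is_iso B (\<epsilon> y)"


section \<open>Bicategories\<close>

text \<open>
  Composition is written in the classical order: \<open>g \<odot> f\<close> is \<open>f\<close> followed by \<open>g\<close>.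
  The constraint 2-cells point as follows:
  \<open>assoc h g f : (h \<odot> g) \<odot> f \<Rightarrow> h \<odot> (g \<odot> f)\<close>, \<open>lunit f : 1 \<odot> f \<Rightarrow> f\<close>,
  \<open>runit f : f \<odot> 1 \<Rightarrow> f\<close>.
\<close>

record ('o, 'm, 'c) bicat =
  Obj   :: "'o set"
  Mor   :: "'m set"
  Cell  :: "'c set"
  src   :: "'m \<Rightarrow> 'o"
  trg   :: "'m \<Rightarrow> 'o"
  src2  :: "'c \<Rightarrow> 'm"
  trg2  :: "'c \<Rightarrow> 'm"
  id1   :: "'o \<Rightarrow> 'm"
  comp1 :: "'m \<Rightarrow> 'm \<Rightarrow> 'm"  (infixr "\<odot>\<index>" 75)
  id2   :: "'m \<Rightarrow> 'c"
  vcomp :: "'c \<Rightarrow> 'c \<Rightarrow> 'c"  (infixr "\<cdot>\<index>" 65)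
  hcomp :: "'c \<Rightarrow> 'c \<Rightarrow> 'c"  (infixr "\<star>\<index>" 75)
  assoc :: "'m \<Rightarrow> 'm \<Rightarrow> 'm \<Rightarrow> 'c"
  lunit :: "'m \<Rightarrow> 'c"
  runit :: "'m \<Rightarrow> 'c"

definition Mors :: "('o, 'm, 'c) bicat \<Rightarrow> 'o \<Rightarrow> 'o \<Rightarrow> 'm set" where
  "Mors B a b = {f \<in> Mor B. src B f = a \<and> trg B f = b}"

definition Cells :: "('o, 'm, 'c) bicat \<Rightarrow> 'm \<Rightarrow> 'm \<Rightarrow> 'c set" where
  "Cells B f g = {\<alpha> \<in> Cell B. src2 B \<alpha> = f \<and> trg2 B \<alpha> = g}"

definition hom :: "('o, 'm, 'c) bicat \<Rightarrow> 'o \<Rightarrow> 'o \<Rightarrow> ('m, 'c) cat" where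
  "hom B a b =
    \<lparr>Ob = Mors B a b,
     Ar = {\<alpha> \<in> Cell B. src2 B \<alpha> \<in> Mors B a b \<and> trg2 B \<alpha> \<in> Mors B a b},
     Dom = src2 B, Cod = trg2 B, Cmp = vcomp B, Idn = id2 B\<rparr>"

definition invertible :: "('o, 'm, 'c) bicat \<Rightarrow> 'c \<Rightarrow> bool" where
  "invertible B \<alpha> \<longleftrightarrow> is_iso (hom B (src B (src2 B \<alpha>)) (trg B (src2 B \<alpha>))) \<alpha>"

abbreviation lwhisker :: "('o, 'm, 'c) bicat \<Rightarrow> 'm \<Rightarrow> 'c \<Rightarrow> 'c"  (infixr "\<rhd>\<index>" 75) where
  "g \<rhd>\<^bsub>B\<^esub> \<alpha> \<equiv> id2 B g \<star>\<^bsub>B\<^esub> \<alpha>"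

abbreviation rwhisker :: "('o, 'm, 'c) bicat \<Rightarrow> 'c \<Rightarrow> 'm \<Rightarrow> 'c"  (infixl "\<lhd>\<index>" 75) where
  "\<beta> \<lhd>\<^bsub>B\<^esub> f \<equiv> \<beta> \<star>\<^bsub>B\<^esub> id2 B f"

locale bicategory =
  fixes B :: "('o, 'm, 'c) bicat" (structure)
  assumes src_closed: "f \<in> Mor B \<Longrightarrow> src B f \<in> Obj B"
    and trg_closed: "f \<in> Mor B \<Longrightarrow> trg B f \<in> Obj B"
    and src2_closed: "\<alpha> \<in> Cell B \<Longrightarrow> src2 B \<alpha> \<in> Mor B"
    and trg2_closed: "\<alpha> \<in> Cell B \<Longrightarrow> trg2 B \<alpha> \<in> Mor B"
    and src_parallel: "\<alpha> \<in> Cell B \<Longrightarrow> src B (src2 B \<alpha>) = src B (trg2 B \<alpha>)"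
    and trg_parallel: "\<alpha> \<in> Cell B \<Longrightarrow> trg B (src2 B \<alpha>) = trg B (trg2 B \<alpha>)"
    and hom_category: "\<lbrakk>a \<in> Obj B; b \<in> Obj B\<rbrakk> \<Longrightarrow> category (hom B a b)"
    and id1_closed: "a \<in> Obj B \<Longrightarrow> id1 B a \<in> Mors B a a"
    and comp1_closed: "\<lbrakk>g \<in> Mors B b c; f \<in> Mors B a b\<rbrakk> \<Longrightarrow> g \<odot> f \<in> Mors B a c"
    and hcomp_closed: "\<lbrakk>g \<in> Mors B b c; f \<in> Mors B a b; \<beta> \<in> Cells B g g'; \<alpha> \<in> Cells B f f'\<rbrakk>
      \<Longrightarrow> \<beta> \<star> \<alpha> \<in> Cells B (g \<odot> f) (g' \<odot> f')"
    and hcomp_id2: "\<lbrakk>g \<in> Mors B b c; f \<in> Mors B a b\<rbrakk> \<Longrightarrow> id2 B g \<star> id2 B f = id2 B (g \<odot> f)"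
    and interchange: "\<lbrakk>g \<in> Mors B b c; f \<in> Mors B a b;
        \<beta> \<in> Cells B g g'; \<beta>' \<in> Cells B g' g''; \<alpha> \<in> Cells B f f'; \<alpha>' \<in> Cells B f' f''\<rbrakk>
      \<Longrightarrow> (\<beta>' \<cdot> \<beta>) \<star> (\<alpha>' \<cdot> \<alpha>) = (\<beta>' \<star> \<alpha>') \<cdot> (\<beta> \<star> \<alpha>)"
    and assoc_closed: "\<lbrakk>h \<in> Mors B c d; g \<in> Mors B b c; f \<in> Mors B a b\<rbrakk>
      \<Longrightarrow> assoc B h g f \<in> Cells B ((h \<odot> g) \<odot> f) (h \<odot> (g \<odot> f))"
    and assoc_invertible: "\<lbrakk>h \<in> Mors B c d; g \<in> Mors B b c; f \<in> Mors B a b\<rbrakk>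
      \<Longrightarrow> invertible B (assoc B h g f)"
    and assoc_natural: "\<lbrakk>h \<in> Mors B c d; g \<in> Mors B b c; f \<in> Mors B a b;
        \<gamma> \<in> Cells B h h'; \<beta> \<in> Cells B g g'; \<alpha> \<in> Cells B f f'\<rbrakk>
      \<Longrightarrow> (\<gamma> \<star> (\<beta> \<star> \<alpha>)) \<cdot> assoc B h g f = assoc B h' g' f' \<cdot> ((\<gamma> \<star> \<beta>) \<star> \<alpha>)"
    and lunit_closed: "f \<in> Mors B a b \<Longrightarrow> lunit B f \<in> Cells B (id1 B b \<odot> f) f"
    and lunit_invertible: "f \<in> Mors B a b \<Longrightarrow> invertible B (lunit B f)"
    and lunit_natural: "\<lbrakk>f \<in> Mors B a b; \<alpha> \<in> Cells B f f'\<rbrakk>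
      \<Longrightarrow> \<alpha> \<cdot> lunit B f = lunit B f' \<cdot> (id1 B b \<rhd> \<alpha>)"
    and runit_closed: "f \<in> Mors B a b \<Longrightarrow> runit B f \<in> Cells B (f \<odot> id1 B a) f"
    and runit_invertible: "f \<in> Mors B a b \<Longrightarrow> invertible B (runit B f)"
    and runit_natural: "\<lbrakk>f \<in> Mors B a b; \<alpha> \<in> Cells B f f'\<rbrakk>
      \<Longrightarrow> \<alpha> \<cdot> runit B f = runit B f' \<cdot> (\<alpha> \<lhd> id1 B a)"
    and pentagon: "\<lbrakk>k \<in> Mors B d e; h \<in> Mors B c d; g \<in> Mors B b c; f \<in> Mors B a b\<rbrakk>
      \<Longrightarrow> (k \<rhd> assoc B h g f) \<cdot> assoc B k (h \<odot> g) f \<cdot> (assoc B k h g \<lhd> f)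
          = assoc B k h (g \<odot> f) \<cdot> assoc B (k \<odot> h) g f"
    and triangle: "\<lbrakk>g \<in> Mors B b c; f \<in> Mors B a b\<rbrakk>
      \<Longrightarrow> (g \<rhd> lunit B f) \<cdot> assoc B g (id1 B b) f = runit B g \<lhd> f"


section \<open>Pseudofunctors\<close>

text \<open>
  The constraint 2-cells of a pseudofunctor \<open>P\<close> are \<open>psf_comp P g f : P g \<odot> P f \<Rightarrow> P (g \<odot> f)\<close>
  and \<open>psf_id P a : 1 \<Rightarrow> P 1\<close>.
\<close>

record ('o, 'm, 'c, 'p, 'n, 'd) psf =
  psf_obj  :: "'o \<Rightarrow> 'p"
  psf_mor  :: "'m \<Rightarrow> 'n"
  psf_cell :: "'c \<Rightarrow> 'd"
  psf_comp :: "'m \<Rightarrow> 'm \<Rightarrow> 'd"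
  psf_id   :: "'o \<Rightarrow> 'd"

locale pseudofunctor = C: bicategory C + D: bicategory D
  for C :: "('o, 'm, 'c) bicat" and D :: "('p, 'n, 'd) bicat" +
  fixes P :: "('o, 'm, 'c, 'p, 'n, 'd) psf"
  assumes psf_obj_closed: "a \<in> Obj C \<Longrightarrow> psf_obj P a \<in> Obj D"
    and psf_hom: "\<lbrakk>a \<in> Obj C; b \<in> Obj C\<rbrakk>
      \<Longrightarrow> cat_functor (hom C a b) (hom D (psf_obj P a) (psf_obj P b))
            \<lparr>on_ob = psf_mor P, on_ar = psf_cell P\<rparr>"
    and psf_comp_closed: "\<lbrakk>g \<in> Mors C b c; f \<in> Mors C a b\<rbrakk>
      \<Longrightarrow> psf_comp P g f \<in> Cells D (psf_mor P g \<odot>\<^bsub>D\<^esub> psf_mor P f) (psf_mor P (g \<odot>\<^bsub>C\<^esub> f))"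
    and psf_comp_invertible: "\<lbrakk>g \<in> Mors C b c; f \<in> Mors C a b\<rbrakk>
      \<Longrightarrow> invertible D (psf_comp P g f)"
    and psf_comp_natural:
      "\<lbrakk>g \<in> Mors C b c; f \<in> Mors C a b; \<beta> \<in> Cells C g g'; \<alpha> \<in> Cells C f f'\<rbrakk>
      \<Longrightarrow> psf_cell P (\<beta> \<star>\<^bsub>C\<^esub> \<alpha>) \<cdot>\<^bsub>D\<^esub> psf_comp P g f
          = psf_comp P g' f' \<cdot>\<^bsub>D\<^esub> (psf_cell P \<beta> \<star>\<^bsub>D\<^esub> psf_cell P \<alpha>)"
    and psf_id_closed: "a \<in> Obj C
      \<Longrightarrow> psf_id P a \<in> Cells D (id1 D (psf_obj P a)) (psf_mor P (id1 C a))"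
    and psf_id_invertible: "a \<in> Obj C \<Longrightarrow> invertible D (psf_id P a)"
    and psf_assoc: "\<lbrakk>h \<in> Mors C c d; g \<in> Mors C b c; f \<in> Mors C a b\<rbrakk>
      \<Longrightarrow> psf_cell P (assoc C h g f) \<cdot>\<^bsub>D\<^esub> psf_comp P (h \<odot>\<^bsub>C\<^esub> g) f
            \<cdot>\<^bsub>D\<^esub> (psf_comp P h g \<lhd>\<^bsub>D\<^esub> psf_mor P f)
          = psf_comp P h (g \<odot>\<^bsub>C\<^esub> f) \<cdot>\<^bsub>D\<^esub> (psf_mor P h \<rhd>\<^bsub>D\<^esub> psf_comp P g f)
            \<cdot>\<^bsub>D\<^esub> assoc D (psf_mor P h) (psf_mor P g) (psf_mor P f)"
    and psf_lunit: "f \<in> Mors C a b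
      \<Longrightarrow> psf_cell P (lunit C f) \<cdot>\<^bsub>D\<^esub> psf_comp P (id1 C b) f
            \<cdot>\<^bsub>D\<^esub> (psf_id P b \<lhd>\<^bsub>D\<^esub> psf_mor P f)
          = lunit D (psf_mor P f)"
    and psf_runit: "f \<in> Mors C a b
      \<Longrightarrow> psf_cell P (runit C f) \<cdot>\<^bsub>D\<^esub> psf_comp P f (id1 C a)
            \<cdot>\<^bsub>D\<^esub> (psf_mor P f \<rhd>\<^bsub>D\<^esub> psf_id P a)
          = runit D (psf_mor P f)"


section \<open>Relative pseudoadjunctions\<close>

text \<open>
  The functors and 2-cells below are indexed by objects \<open>X\<close> of \<open>C\<close> and \<open>A\<close> of \<open>E\<close>, since a
  morphism \<open>J X \<rightarrow> G A\<close> of \<open>D\<close> need not determine \<open>X\<close> and \<open>A\<close>.  For \<open>f : J X \<rightarrow> G A\<close>,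
  \<open>rpa_sharp F X A\<close> acts on \<open>f\<close> as the functor \<open>f \<mapsto> f\<^sup>\<sharp>\<close>, and the adjunction has unit
  \<open>rpa_unit F X A f : f \<Rightarrow> G (f\<^sup>\<sharp>) \<odot> i\<close> and, for \<open>u : F X \<rightarrow> A\<close>, counit
  \<open>rpa_counit F X A u : (G u \<odot> i)\<^sup>\<sharp> \<Rightarrow> u\<close>.
\<close>

record ('oc, 'md, 'cd, 'oe, 'me, 'ce) rpa =
  rpa_obj    :: "'oc \<Rightarrow> 'oe"
  rpa_i      :: "'oc \<Rightarrow> 'md"
  rpa_sharp  :: "'oc \<Rightarrow> 'oe \<Rightarrow> ('md, 'cd, 'me, 'ce) fctr"
  rpa_unit   :: "'oc \<Rightarrow> 'oe \<Rightarrow> 'md \<Rightarrow> 'cd"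
  rpa_counit :: "'oc \<Rightarrow> 'oe \<Rightarrow> 'me \<Rightarrow> 'ce"

text \<open>The functor \<open>G(-) i\<close> given by application of \<open>G\<close> and precomposition with \<open>i\<close>.\<close>

definition apply_precomp ::
    "('p, 'n, 'd) bicat \<Rightarrow> ('o, 'm, 'c, 'p, 'n, 'd) psf \<Rightarrow> 'n \<Rightarrow> ('m, 'c, 'n, 'd) fctr" where
  "apply_precomp D G i =
    \<lparr>on_ob = (\<lambda>u. psf_mor G u \<odot>\<^bsub>D\<^esub> i), on_ar = (\<lambda>\<alpha>. psf_cell G \<alpha> \<lhd>\<^bsub>D\<^esub> i)\<rparr>"

locale relative_pseudoadjunction = J: pseudofunctor C D J + G: pseudofunctor E D G
  for C :: "('oc, 'mc, 'cc) bicat" and D :: "('od, 'md, 'cd) bicat"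
    and E :: "('oe, 'me, 'ce) bicat"
    and J :: "('oc, 'mc, 'cc, 'od, 'md, 'cd) psf"
    and G :: "('oe, 'me, 'ce, 'od, 'md, 'cd) psf" +
  fixes F :: "('oc, 'md, 'cd, 'oe, 'me, 'ce) rpa"
  assumes rpa_obj_closed: "X \<in> Obj C \<Longrightarrow> rpa_obj F X \<in> Obj E"
    and rpa_i_closed: "X \<in> Obj C
      \<Longrightarrow> rpa_i F X \<in> Mors D (psf_obj J X) (psf_obj G (rpa_obj F X))"
    and rpa_adjoint_equivalence: "\<lbrakk>X \<in> Obj C; A \<in> Obj E\<rbrakk>
      \<Longrightarrow> adjoint_equivalence (hom D (psf_obj J X) (psf_obj G A)) (hom E (rpa_obj F X) A)
            (rpa_sharp F X A) (apply_precomp D G (rpa_i F X))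
            (rpa_unit F X A) (rpa_counit F X A)"


section \<open>Relative pseudomonads\<close>

text \<open>
  As above, all data are indexed by the relevant objects of \<open>C\<close>: for \<open>f : J X \<rightarrow> T Y\<close> and
  \<open>g : J Y \<rightarrow> T Z\<close> we have \<open>rpm_mu T X Y Z g f : (g\<^sup>* \<odot> f)\<^sup>* \<Rightarrow> g\<^sup>* \<odot> f\<^sup>*\<close> and
  \<open>rpm_eta T X Y f : f \<Rightarrow> f\<^sup>* \<odot> i\<close>, and \<open>rpm_theta T X : i\<^sup>* \<Rightarrow> 1\<close>.  The constraint 2-cells
  of \<open>D\<close>, customarily suppressed, are inserted in the two coherence axioms.
\<close>

record ('oc, 'od, 'md, 'cd) rpm =
  rpm_obj   :: "'oc \<Rightarrow> 'od"
  rpm_i     :: "'oc \<Rightarrow> 'md"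
  rpm_star  :: "'oc \<Rightarrow> 'oc \<Rightarrow> ('md, 'cd, 'md, 'cd) fctr"
  rpm_mu    :: "'oc \<Rightarrow> 'oc \<Rightarrow> 'oc \<Rightarrow> 'md \<Rightarrow> 'md \<Rightarrow> 'cd"
  rpm_eta   :: "'oc \<Rightarrow> 'oc \<Rightarrow> 'md \<Rightarrow> 'cd"
  rpm_theta :: "'oc \<Rightarrow> 'cd"

abbreviation ext1 ::
    "('oc, 'od, 'md, 'cd) rpm \<Rightarrow> 'oc \<Rightarrow> 'oc \<Rightarrow> 'md \<Rightarrow> 'md" where
  "ext1 T X Y f \<equiv> on_ob (rpm_star T X Y) f"

abbreviation ext2 ::
    "('oc, 'od, 'md, 'cd) rpm \<Rightarrow> 'oc \<Rightarrow> 'oc \<Rightarrow> 'cd \<Rightarrow> 'cd" where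
  "ext2 T X Y \<alpha> \<equiv> on_ar (rpm_star T X Y) \<alpha>"

locale relative_pseudomonad = J: pseudofunctor C D J
  for C :: "('oc, 'mc, 'cc) bicat" and D :: "('od, 'md, 'cd) bicat"
    and J :: "('oc, 'mc, 'cc, 'od, 'md, 'cd) psf" +
  fixes T :: "('oc, 'od, 'md, 'cd) rpm"
  assumes rpm_obj_closed: "X \<in> Obj C \<Longrightarrow> rpm_obj T X \<in> Obj D"
    and rpm_i_closed: "X \<in> Obj C \<Longrightarrow> rpm_i T X \<in> Mors D (psf_obj J X) (rpm_obj T X)"
    and rpm_star_functor: "\<lbrakk>X \<in> Obj C; Y \<in> Obj C\<rbrakk>
      \<Longrightarrow> cat_functor (hom D (psf_obj J X) (rpm_obj T Y)) (hom D (rpm_obj T X) (rpm_obj T Y))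
            (rpm_star T X Y)"
    and mu_closed: "\<lbrakk>X \<in> Obj C; Y \<in> Obj C; Z \<in> Obj C;
        f \<in> Mors D (psf_obj J X) (rpm_obj T Y); g \<in> Mors D (psf_obj J Y) (rpm_obj T Z)\<rbrakk>
      \<Longrightarrow> rpm_mu T X Y Z g f
          \<in> Cells D (ext1 T X Z (ext1 T Y Z g \<odot>\<^bsub>D\<^esub> f)) (ext1 T Y Z g \<odot>\<^bsub>D\<^esub> ext1 T X Y f)"
    and mu_invertible: "\<lbrakk>X \<in> Obj C; Y \<in> Obj C; Z \<in> Obj C;
        f \<in> Mors D (psf_obj J X) (rpm_obj T Y); g \<in> Mors D (psf_obj J Y) (rpm_obj T Z)\<rbrakk>
      \<Longrightarrow> invertible D (rpm_mu T X Y Z g f)"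
    and mu_natural: "\<lbrakk>X \<in> Obj C; Y \<in> Obj C; Z \<in> Obj C;
        f \<in> Mors D (psf_obj J X) (rpm_obj T Y); g \<in> Mors D (psf_obj J Y) (rpm_obj T Z);
        \<alpha> \<in> Cells D f f'; \<beta> \<in> Cells D g g'\<rbrakk>
      \<Longrightarrow> (ext2 T Y Z \<beta> \<star>\<^bsub>D\<^esub> ext2 T X Y \<alpha>) \<cdot>\<^bsub>D\<^esub> rpm_mu T X Y Z g f
          = rpm_mu T X Y Z g' f' \<cdot>\<^bsub>D\<^esub> ext2 T X Z (ext2 T Y Z \<beta> \<star>\<^bsub>D\<^esub> \<alpha>)"
    and eta_closed: "\<lbrakk>X \<in> Obj C; Y \<in> Obj C; f \<in> Mors D (psf_obj J X) (rpm_obj T Y)\<rbrakk>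
      \<Longrightarrow> rpm_eta T X Y f \<in> Cells D f (ext1 T X Y f \<odot>\<^bsub>D\<^esub> rpm_i T X)"
    and eta_invertible: "\<lbrakk>X \<in> Obj C; Y \<in> Obj C; f \<in> Mors D (psf_obj J X) (rpm_obj T Y)\<rbrakk>
      \<Longrightarrow> invertible D (rpm_eta T X Y f)"
    and eta_natural: "\<lbrakk>X \<in> Obj C; Y \<in> Obj C; f \<in> Mors D (psf_obj J X) (rpm_obj T Y);
        \<alpha> \<in> Cells D f f'\<rbrakk>
      \<Longrightarrow> (ext2 T X Y \<alpha> \<lhd>\<^bsub>D\<^esub> rpm_i T X) \<cdot>\<^bsub>D\<^esub> rpm_eta T X Y f = rpm_eta T X Y f' \<cdot>\<^bsub>D\<^esub> \<alpha>"
    and theta_closed: "X \<in> Obj C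
      \<Longrightarrow> rpm_theta T X \<in> Cells D (ext1 T X X (rpm_i T X)) (id1 D (rpm_obj T X))"
    and theta_invertible: "X \<in> Obj C \<Longrightarrow> invertible D (rpm_theta T X)"
    and associativity: "\<lbrakk>X \<in> Obj C; Y \<in> Obj C; Z \<in> Obj C; V \<in> Obj C;
        f \<in> Mors D (psf_obj J X) (rpm_obj T Y); g \<in> Mors D (psf_obj J Y) (rpm_obj T Z);
        h \<in> Mors D (psf_obj J Z) (rpm_obj T V)\<rbrakk>
      \<Longrightarrow> (ext1 T Z V h \<rhd>\<^bsub>D\<^esub> rpm_mu T X Y Z g f)
            \<cdot>\<^bsub>D\<^esub> rpm_mu T X Z V h (ext1 T Y Z g \<odot>\<^bsub>D\<^esub> f)
            \<cdot>\<^bsub>D\<^esub> ext2 T X V (assoc D (ext1 T Z V h) (ext1 T Y Z g) f)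
            \<cdot>\<^bsub>D\<^esub> ext2 T X V (rpm_mu T Y Z V h g \<lhd>\<^bsub>D\<^esub> f)
          = assoc D (ext1 T Z V h) (ext1 T Y Z g) (ext1 T X Y f)
            \<cdot>\<^bsub>D\<^esub> (rpm_mu T Y Z V h g \<lhd>\<^bsub>D\<^esub> ext1 T X Y f)
            \<cdot>\<^bsub>D\<^esub> rpm_mu T X Y V (ext1 T Z V h \<odot>\<^bsub>D\<^esub> g) f"
    and unit: "\<lbrakk>X \<in> Obj C; Y \<in> Obj C; f \<in> Mors D (psf_obj J X) (rpm_obj T Y)\<rbrakk>
      \<Longrightarrow> runit D (ext1 T X Y f)
            \<cdot>\<^bsub>D\<^esub> (ext1 T X Y f \<rhd>\<^bsub>D\<^esub> rpm_theta T X)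
            \<cdot>\<^bsub>D\<^esub> rpm_mu T X X Y f (rpm_i T X)
            \<cdot>\<^bsub>D\<^esub> ext2 T X Y (rpm_eta T X Y f)
          = id2 D (ext1 T X Y f)"

end

theory Submission
  imports Defs
begin

text \<open>
  For \<open>u : A \<rightarrow> B\<close> in \<open>E\<close> and \<open>f : J X \<rightarrow> G A\<close> in \<open>D\<close>, let \<open>\<kappa>\<^sub>u\<^sub>,\<^sub>f : (G u \<odot> f)\<^sup>\<sharp> \<Rightarrow> u \<odot> f\<^sup>\<sharp>\<close> be the
  transpose of the canonical 2-cell \<open>G u \<odot> f \<Rightarrow> G u \<odot> (G f\<^sup>\<sharp> \<odot> i) \<cong> G (u \<odot> f\<^sup>\<sharp>) \<odot> i\<close>; it is invertible
  because the adjunction is an equivalence.  The pseudomonad has \<open>f\<^sup>* = G f\<^sup>\<sharp>\<close>, its \<open>\<eta>\<close> is the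
  unit of the adjunction, \<open>\<mu>\<^sub>g\<^sub>,\<^sub>f\<close> is \<open>G \<kappa>\<close> at \<open>u = g\<^sup>\<sharp>\<close> followed by the inverse of the compositor of
  \<open>G\<close>, and \<open>\<theta>\<close> is \<open>G\<close> of the transpose of \<open>i \<cong> G 1 \<odot> i\<close> followed by the inverse of the unitor
  of \<open>G\<close>.  Since the \<open>\<kappa>\<close> are defined at all \<open>u\<close>, the two axioms reduce to identities between 2-cells
  \<open>h\<^sup>\<sharp> \<Rightarrow> w\<close> of \<open>E\<close>, which can be tested after transposition; there they become the
  coherence axioms of \<open>D\<close> and \<open>G\<close>.
\<close>

section \<open>Bicategories\<close>

lemma in_Mors: "f \<in> Mors B a b \<longleftrightarrow> f \<in> Mor B \<and> src B f = a \<and> trg B f = b"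
  by (auto simp: Mors_def)

lemma in_Cells: "\<alpha> \<in> Cells B f g \<longleftrightarrow> \<alpha> \<in> Cell B \<and> src2 B \<alpha> = f \<and> trg2 B \<alpha> = g"
  by (auto simp: Cells_def)

text \<open>Membership in the carriers is unfolded into equations between boundaries. With these as
  conditional simp rules the simplifier itself computes the source and target of every pasted
  2-cell.\<close>

lemma in_Arr_hom:
  "\<alpha> \<in> Arr (hom B a b) f g \<longleftrightarrow>
    \<alpha> \<in> Cell B \<and> src2 B \<alpha> = f \<and> trg2 B \<alpha> = g \<and> f \<in> Mors B a b \<and> g \<in> Mors B a b"
  by (auto simp: Arr_def hom_def)

lemma hom_simps [simp]:
  "Ob (hom B a b) = Mors B a b" "Dom (hom B a b) = src2 B" "Cod (hom B a b) = trg2 B"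
  "Cmp (hom B a b) = vcomp B" "Idn (hom B a b) = id2 B"
  by (simp_all add: hom_def)

text \<open>Invertibility only asserts that an inverse exists, so one is named by choice. The value
  is meaningful for invertible \<alpha> alone.\<close>

definition inv2 :: "('o, 'm, 'c) bicat \<Rightarrow> 'c \<Rightarrow> 'c" where
  "inv2 B \<alpha> = (SOME \<beta>. \<beta> \<in> Cell B \<and> src2 B \<beta> = trg2 B \<alpha> \<and> trg2 B \<beta> = src2 B \<alpha> \<and>
     \<beta> \<cdot>\<^bsub>B\<^esub> \<alpha> = id2 B (src2 B \<alpha>) \<and> \<alpha> \<cdot>\<^bsub>B\<^esub> \<beta> = id2 B (trg2 B \<alpha>))"

context bicategory
begin

declare src_closed [simp] trg_closed [simp] src2_closed [simp] trg2_closed [simp]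

lemma src_trg2 [simp]: "\<alpha> \<in> Cell B \<Longrightarrow> src B (trg2 B \<alpha>) = src B (src2 B \<alpha>)"
  and trg_trg2 [simp]: "\<alpha> \<in> Cell B \<Longrightarrow> trg B (trg2 B \<alpha>) = trg B (src2 B \<alpha>)"
  by (simp_all add: src_parallel trg_parallel)

lemma id1_simps [simp]:
  assumes "a \<in> Obj B"
  shows "id1 B a \<in> Mor B" "src B (id1 B a) = a" "trg B (id1 B a) = a"
  using id1_closed[OF assms] by (auto simp: in_Mors)

lemma comp1_simps [simp]:
  assumes "g \<in> Mor B" "f \<in> Mor B" "src B g = trg B f"
  shows "g \<odot> f \<in> Mor B" "src B (g \<odot> f) = src B f" "trg B (g \<odot> f) = trg B g"
  using comp1_closed[of g "src B g" "trg B g" f "src B f"] assms by (auto simp: in_Mors)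

lemma hom_category_Mor:
  "f \<in> Mor B \<Longrightarrow> category (hom B (src B f) (trg B f))"
  by (simp add: hom_category)

lemma id2_simps [simp]:
  assumes "f \<in> Mor B"
  shows "id2 B f \<in> Cell B" "src2 B (id2 B f) = f" "trg2 B (id2 B f) = f"
  using category.Idn_closed[OF hom_category_Mor[OF assms], of f] assms
  by (auto simp: in_Arr_hom in_Mors)

lemma vcomp_simps [simp]:
  assumes "\<beta> \<in> Cell B" "\<alpha> \<in> Cell B" "src2 B \<beta> = trg2 B \<alpha>"
  shows "\<beta> \<cdot> \<alpha> \<in> Cell B" "src2 B (\<beta> \<cdot> \<alpha>) = src2 B \<alpha>" "trg2 B (\<beta> \<cdot> \<alpha>) = trg2 B \<beta>"
proof -
  have "\<beta> \<cdot> \<alpha> \<in> Arr (hom B (src B (src2 B \<alpha>)) (trg B (src2 B \<alpha>))) (src2 B \<alpha>) (trg2 B \<beta>)"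
    using category.Cmp_closed[OF hom_category_Mor[of "src2 B \<alpha>"], of \<beta> "trg2 B \<alpha>" "trg2 B \<beta>" \<alpha> "src2 B \<alpha>"]
      assms src_parallel[of \<beta>] trg_parallel[of \<beta>]
    by (auto simp: in_Arr_hom in_Mors)
  then show "\<beta> \<cdot> \<alpha> \<in> Cell B" "src2 B (\<beta> \<cdot> \<alpha>) = src2 B \<alpha>" "trg2 B (\<beta> \<cdot> \<alpha>) = trg2 B \<beta>"
    by (auto simp: in_Arr_hom)
qed

lemma vcomp_id2_left [simp]: "\<lbrakk>\<alpha> \<in> Cell B; trg2 B \<alpha> = g\<rbrakk> \<Longrightarrow> id2 B g \<cdot> \<alpha> = \<alpha>"
  using category.Cmp_Idn_left[OF hom_category_Mor[of "src2 B \<alpha>"], of \<alpha> "src2 B \<alpha>" "trg2 B \<alpha>"]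
  by (auto simp: in_Arr_hom in_Mors)

lemma vcomp_id2_right [simp]: "\<lbrakk>\<alpha> \<in> Cell B; src2 B \<alpha> = f\<rbrakk> \<Longrightarrow> \<alpha> \<cdot> id2 B f = \<alpha>"
  using category.Cmp_Idn_right[OF hom_category_Mor[of "src2 B \<alpha>"], of \<alpha> "src2 B \<alpha>" "trg2 B \<alpha>"]
  by (auto simp: in_Arr_hom in_Mors)

lemma vcomp_assoc [simp]:
  assumes "\<gamma> \<in> Cell B" "\<beta> \<in> Cell B" "\<alpha> \<in> Cell B" "src2 B \<gamma> = trg2 B \<beta>" "src2 B \<beta> = trg2 B \<alpha>"
  shows "(\<gamma> \<cdot> \<beta>) \<cdot> \<alpha> = \<gamma> \<cdot> (\<beta> \<cdot> \<alpha>)"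
  using category.Cmp_assoc[OF hom_category_Mor[of "src2 B \<alpha>"],
      of \<gamma> "src2 B \<gamma>" "trg2 B \<gamma>" \<beta> "src2 B \<beta>" \<alpha> "src2 B \<alpha>"]
    assms src_parallel[of \<beta>] trg_parallel[of \<beta>] src_parallel[of \<gamma>] trg_parallel[of \<gamma>]
  by (auto simp: in_Arr_hom in_Mors)

text \<open>Extends an equation of composites by a further factor on the right, in the bracketing
  that \<open>vcomp_assoc\<close> normalises to.\<close>

lemma vcomp_eq_extend:
  assumes "\<beta> \<cdot> \<alpha> = \<beta>' \<cdot> \<alpha>'" "\<beta> \<in> Cell B" "\<alpha> \<in> Cell B" "src2 B \<beta> = trg2 B \<alpha>"
    "\<beta>' \<in> Cell B" "\<alpha>' \<in> Cell B" "src2 B \<beta>' = trg2 B \<alpha>'"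
    "\<xi> \<in> Cell B" "trg2 B \<xi> = src2 B \<alpha>"
  shows "\<beta> \<cdot> \<alpha> \<cdot> \<xi> = \<beta>' \<cdot> \<alpha>' \<cdot> \<xi>"
proof -
  \<comment> \<open>Equal composites have equal sources, which makes \<open>\<xi>\<close> composable
    with \<open>\<alpha>'\<close> as well.\<close>
  have "src2 B \<alpha>' = src2 B \<alpha>"
    using assms(1-7) vcomp_simps(2) by metis
  then show ?thesis
    using vcomp_assoc[of \<beta> \<alpha> \<xi>] vcomp_assoc[of \<beta>' \<alpha>' \<xi>] assms by metis
qed

text \<open>Variant in which one side is a single cell: it rewrites a pair inside a longer chain,
  typically to cancel two whiskered mutual inverses.\<close>

lemma vcomp_eq_extend1:
  assumes "\<beta> \<cdot> \<alpha> = \<gamma>" "\<beta> \<in> Cell B" "\<alpha> \<in> Cell B" "src2 B \<beta> = trg2 B \<alpha>"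
    "\<xi> \<in> Cell B" "trg2 B \<xi> = src2 B \<alpha>"
  shows "\<beta> \<cdot> \<alpha> \<cdot> \<xi> = \<gamma> \<cdot> \<xi>"
  using vcomp_assoc[of \<beta> \<alpha> \<xi>] assms by metis

section \<open>Horizontal composition and whiskering\<close>

lemma hcomp_simps [simp]:
  assumes "\<beta> \<in> Cell B" "\<alpha> \<in> Cell B" "src B (src2 B \<beta>) = trg B (src2 B \<alpha>)"
  shows "\<beta> \<star> \<alpha> \<in> Cell B" "src2 B (\<beta> \<star> \<alpha>) = src2 B \<beta> \<odot> src2 B \<alpha>"
    "trg2 B (\<beta> \<star> \<alpha>) = trg2 B \<beta> \<odot> trg2 B \<alpha>"
  using hcomp_closed[of "src2 B \<beta>" "src B (src2 B \<beta>)" "trg B (src2 B \<beta>)" "src2 B \<alpha>" "src B (src2 B \<alpha>)"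
      \<beta> "trg2 B \<beta>" \<alpha> "trg2 B \<alpha>"] assms
  by (auto simp: in_Mors in_Cells)

lemma hcomp_id2_id2 [simp]:
  "\<lbrakk>g \<in> Mor B; f \<in> Mor B; src B g = trg B f\<rbrakk> \<Longrightarrow> id2 B g \<star> id2 B f = id2 B (g \<odot> f)"
  by (rule hcomp_id2[of g "src B g" "trg B g" f "src B f"]) (auto simp: in_Mors)

lemma hcomp_vcomp:
  assumes "\<beta> \<in> Cell B" "\<beta>' \<in> Cell B" "\<alpha> \<in> Cell B" "\<alpha>' \<in> Cell B"
    "src2 B \<beta>' = trg2 B \<beta>" "src2 B \<alpha>' = trg2 B \<alpha>" "src B (src2 B \<beta>) = trg B (src2 B \<alpha>)"
  shows "(\<beta>' \<star> \<alpha>') \<cdot> (\<beta> \<star> \<alpha>) = (\<beta>' \<cdot> \<beta>) \<star> (\<alpha>' \<cdot> \<alpha>)"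
  using interchange[of "src2 B \<beta>" "src B (src2 B \<beta>)" "trg B (src2 B \<beta>)" "src2 B \<alpha>" "src B (src2 B \<alpha>)"
      \<beta> "trg2 B \<beta>" \<beta>' "trg2 B \<beta>'" \<alpha> "trg2 B \<alpha>" \<alpha>' "trg2 B \<alpha>'"] assms
  by (auto simp: in_Mors in_Cells)

text \<open>Oriented so as to fuse whiskered cells; used in reverse (\<open>flip:\<close>) where a
  whiskered composite has to be split.\<close>

lemma lwhisker_vcomp:
  "\<lbrakk>g \<in> Mor B; \<beta> \<in> Cell B; \<alpha> \<in> Cell B; src2 B \<beta> = trg2 B \<alpha>; src B g = trg B (src2 B \<alpha>)\<rbrakk>
    \<Longrightarrow> (g \<rhd> \<beta>) \<cdot> (g \<rhd> \<alpha>) = g \<rhd> (\<beta> \<cdot> \<alpha>)"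
  by (simp add: hcomp_vcomp)

lemma rwhisker_vcomp:
  "\<lbrakk>f \<in> Mor B; \<beta> \<in> Cell B; \<alpha> \<in> Cell B; src2 B \<beta> = trg2 B \<alpha>; trg B f = src B (src2 B \<alpha>)\<rbrakk>
    \<Longrightarrow> (\<beta> \<lhd> f) \<cdot> (\<alpha> \<lhd> f) = (\<beta> \<cdot> \<alpha>) \<lhd> f"
  by (simp add: hcomp_vcomp)

section \<open>Invertible 2-cells\<close>

lemma invertible_iff:
  "invertible B \<alpha> \<longleftrightarrow> \<alpha> \<in> Cell B \<and> (\<exists>\<beta> \<in> Cell B. src2 B \<beta> = trg2 B \<alpha> \<and> trg2 B \<beta> = src2 B \<alpha> \<and>
     \<beta> \<cdot> \<alpha> = id2 B (src2 B \<alpha>) \<and> \<alpha> \<cdot> \<beta> = id2 B (trg2 B \<alpha>))"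
  (is "_ \<longleftrightarrow> ?R")
proof
  show "invertible B \<alpha> \<Longrightarrow> ?R"
    unfolding invertible_def is_iso_def in_Arr_hom Bex_def hom_simps by (auto simp: hom_def)
next
  assume R: ?R
  then have "\<alpha> \<in> Ar (hom B (src B (src2 B \<alpha>)) (trg B (src2 B \<alpha>)))"
    by (simp add: hom_def in_Mors)
  \<comment> \<open>The hom-category in \<open>invertible\<close> is fixed by the source of
    \<alpha>. Since the two ends of a 2-cell are parallel, the candidate inverse lies in that same
    hom-category.\<close>
  with R show "invertible B \<alpha>"
    unfolding invertible_def is_iso_def in_Arr_hom Bex_def hom_simps in_Mors
    using src2_closed trg2_closed src_trg2 trg_trg2 by metis
qed

lemma invertible_Cell: "invertible B \<alpha> \<Longrightarrow> \<alpha> \<in> Cell B"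
  by (simp add: invertible_iff)

lemma inv2_simps [simp]:
  assumes "invertible B \<alpha>"
  shows "inv2 B \<alpha> \<in> Cell B" "src2 B (inv2 B \<alpha>) = trg2 B \<alpha>" "trg2 B (inv2 B \<alpha>) = src2 B \<alpha>"
    "inv2 B \<alpha> \<cdot> \<alpha> = id2 B (src2 B \<alpha>)" "\<alpha> \<cdot> inv2 B \<alpha> = id2 B (trg2 B \<alpha>)"
proof -
  have "\<exists>\<beta>. \<beta> \<in> Cell B \<and> src2 B \<beta> = trg2 B \<alpha> \<and> trg2 B \<beta> = src2 B \<alpha> \<and>
     \<beta> \<cdot> \<alpha> = id2 B (src2 B \<alpha>) \<and> \<alpha> \<cdot> \<beta> = id2 B (trg2 B \<alpha>)"
    using assms unfolding invertible_iff by blast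
  from someI_ex[OF this, folded inv2_def]
  show "inv2 B \<alpha> \<in> Cell B" "src2 B (inv2 B \<alpha>) = trg2 B \<alpha>" "trg2 B (inv2 B \<alpha>) = src2 B \<alpha>"
    "inv2 B \<alpha> \<cdot> \<alpha> = id2 B (src2 B \<alpha>)" "\<alpha> \<cdot> inv2 B \<alpha> = id2 B (trg2 B \<alpha>)"
    by auto
qed

lemma inv2_cancel [simp]:
  assumes "invertible B \<alpha>" "\<xi> \<in> Cell B"
  shows "trg2 B \<xi> = src2 B \<alpha> \<Longrightarrow> inv2 B \<alpha> \<cdot> \<alpha> \<cdot> \<xi> = \<xi>"
    and "trg2 B \<xi> = trg2 B \<alpha> \<Longrightarrow> \<alpha> \<cdot> inv2 B \<alpha> \<cdot> \<xi> = \<xi>"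
  using vcomp_eq_extend1[of "inv2 B \<alpha>" \<alpha> _ \<xi>] vcomp_eq_extend1[of \<alpha> "inv2 B \<alpha>" _ \<xi>] assms
  by (simp_all add: invertible_Cell)

lemma invertible_id2 [simp]: "f \<in> Mor B \<Longrightarrow> invertible B (id2 B f)"
  unfolding invertible_iff by (auto intro!: bexI[of _ "id2 B f"])

lemma invertible_inv2 [simp]: "invertible B \<alpha> \<Longrightarrow> invertible B (inv2 B \<alpha>)"
  using invertible_Cell[of \<alpha>] unfolding invertible_iff[of "inv2 B \<alpha>"]
  by (auto intro!: bexI[of _ \<alpha>])

lemma invertible_vcomp [simp]:
  assumes "invertible B \<beta>" "invertible B \<alpha>" "src2 B \<beta> = trg2 B \<alpha>"
  shows "invertible B (\<beta> \<cdot> \<alpha>)"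
  using assms invertible_Cell[of \<alpha>] invertible_Cell[of \<beta>] unfolding invertible_iff[of "\<beta> \<cdot> \<alpha>"]
  by (auto intro!: bexI[of _ "inv2 B \<alpha> \<cdot> inv2 B \<beta>"])

lemma invertible_hcomp [simp]:
  assumes "invertible B \<beta>" "invertible B \<alpha>" "src B (src2 B \<beta>) = trg B (src2 B \<alpha>)"
  shows "invertible B (\<beta> \<star> \<alpha>)"
  using assms invertible_Cell[of \<alpha>] invertible_Cell[of \<beta>] unfolding invertible_iff[of "\<beta> \<star> \<alpha>"]
  by (auto simp: hcomp_vcomp intro!: bexI[of _ "inv2 B \<beta> \<star> inv2 B \<alpha>"])

lemma is_iso_invertible:
  "\<lbrakk>is_iso (hom B a b) \<alpha>\<rbrakk> \<Longrightarrow> invertible B \<alpha>"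
  unfolding is_iso_def invertible_iff by (auto simp: in_Arr_hom) (auto simp: hom_def)

section \<open>Constraint 2-cells and the coherence laws solved for their inverses\<close>

lemma assoc_simps [simp]:
  assumes "h \<in> Mor B" "g \<in> Mor B" "f \<in> Mor B" "src B h = trg B g" "src B g = trg B f"
  shows "assoc B h g f \<in> Cell B" "src2 B (assoc B h g f) = (h \<odot> g) \<odot> f"
    "trg2 B (assoc B h g f) = h \<odot> (g \<odot> f)" "invertible B (assoc B h g f)"
  using assoc_closed[of h "src B h" "trg B h" g "src B g" f "src B f"]
    assoc_invertible[of h "src B h" "trg B h" g "src B g" f "src B f"] assms
  by (auto simp: in_Mors in_Cells)

lemma assoc_nat:
  assumes "\<gamma> \<in> Cell B" "\<beta> \<in> Cell B" "\<alpha> \<in> Cell B"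
    "src B (src2 B \<gamma>) = trg B (src2 B \<beta>)" "src B (src2 B \<beta>) = trg B (src2 B \<alpha>)"
  shows "(\<gamma> \<star> \<beta> \<star> \<alpha>) \<cdot> assoc B (src2 B \<gamma>) (src2 B \<beta>) (src2 B \<alpha>)
    = assoc B (trg2 B \<gamma>) (trg2 B \<beta>) (trg2 B \<alpha>) \<cdot> ((\<gamma> \<star> \<beta>) \<star> \<alpha>)"
  using assoc_natural[of "src2 B \<gamma>" "src B (src2 B \<gamma>)" "trg B (src2 B \<gamma>)"
      "src2 B \<beta>" "src B (src2 B \<beta>)" "src2 B \<alpha>" "src B (src2 B \<alpha>)"
      \<gamma> "trg2 B \<gamma>" \<beta> "trg2 B \<beta>" \<alpha> "trg2 B \<alpha>"] assms
  by (auto simp: in_Mors in_Cells)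

text \<open>The naturality square of the associator, conjugated by the inverses of its two
  associators. The boundaries are named by separate equations so that the rule also matches terms in
  which they have already been simplified.\<close>

lemma inv_assoc_nat:
  assumes "\<gamma> \<in> Cell B" "\<beta> \<in> Cell B" "\<alpha> \<in> Cell B"
    "src B (src2 B \<gamma>) = trg B (src2 B \<beta>)" "src B (src2 B \<beta>) = trg B (src2 B \<alpha>)"
    "h = src2 B \<gamma>" "g = src2 B \<beta>" "f = src2 B \<alpha>"
    "h' = trg2 B \<gamma>" "g' = trg2 B \<beta>" "f' = trg2 B \<alpha>"
  shows "inv2 B (assoc B h' g' f') \<cdot> (\<gamma> \<star> \<beta> \<star> \<alpha>)
    = ((\<gamma> \<star> \<beta>) \<star> \<alpha>) \<cdot> inv2 B (assoc B h g f)"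
proof -
  let ?a = "assoc B h g f" and ?a' = "assoc B h' g' f'"
  have "inv2 B ?a' \<cdot> (\<gamma> \<star> \<beta> \<star> \<alpha>) = inv2 B ?a' \<cdot> ((\<gamma> \<star> \<beta> \<star> \<alpha>) \<cdot> ?a) \<cdot> inv2 B ?a"
    using assms by simp
  also have "\<dots> = ((\<gamma> \<star> \<beta>) \<star> \<alpha>) \<cdot> inv2 B ?a"
    unfolding assms(6-11) using assms(1-5) by (subst assoc_nat) simp_all
  finally show ?thesis .
qed

lemma lunit_simps [simp]:
  assumes "f \<in> Mor B" "b = trg B f"
  shows "lunit B f \<in> Cell B" "src2 B (lunit B f) = id1 B b \<odot> f"
    "trg2 B (lunit B f) = f" "invertible B (lunit B f)"
  using lunit_closed[of f "src B f" "trg B f"] lunit_invertible[of f "src B f" "trg B f"] assms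
  by (auto simp: in_Mors in_Cells)

lemma runit_simps [simp]:
  assumes "f \<in> Mor B"
  shows "runit B f \<in> Cell B" "src2 B (runit B f) = f \<odot> id1 B (src B f)"
    "trg2 B (runit B f) = f" "invertible B (runit B f)"
  using runit_closed[of f "src B f" "trg B f"] runit_invertible[of f "src B f" "trg B f"] assms
  by (auto simp: in_Mors in_Cells)

text \<open>The pentagon in the form needed for \<open>kcell\<close>, which contains an inverse
  associator. Inserting \<open>assoc B (k \<odot> h) g f\<close> and its inverse exposes one side of
  the pentagon; after replacing it by the other side, the factors on the left cancel.\<close>

lemma inv_pentagon:
  assumes "k \<in> Mor B" "h \<in> Mor B" "g \<in> Mor B" "f \<in> Mor B"
    "src B k = trg B h" "src B h = trg B g" "src B g = trg B f"
  shows "inv2 B (assoc B k (h \<odot> g) f) \<cdot> (k \<rhd> inv2 B (assoc B h g f)) \<cdot> assoc B k h (g \<odot> f)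
    = (assoc B k h g \<lhd> f) \<cdot> inv2 B (assoc B (k \<odot> h) g f)"
proof -
  let ?x = "inv2 B (assoc B k (h \<odot> g) f)" and ?y = "k \<rhd> inv2 B (assoc B h g f)"
    and ?z = "inv2 B (assoc B (k \<odot> h) g f)"
  have pent: "(k \<rhd> assoc B h g f) \<cdot> assoc B k (h \<odot> g) f \<cdot> (assoc B k h g \<lhd> f)
      = assoc B k h (g \<odot> f) \<cdot> assoc B (k \<odot> h) g f"
    using assms by (intro pentagon[of k "src B k" "trg B k" h "src B h" g "src B g" f "src B f"])
      (auto simp: in_Mors)
  have "?x \<cdot> ?y \<cdot> assoc B k h (g \<odot> f)
      = ?x \<cdot> ?y \<cdot> (assoc B k h (g \<odot> f) \<cdot> assoc B (k \<odot> h) g f) \<cdot> ?z"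
    using assms by simp
  also have "\<dots> = ?x \<cdot> (?y \<cdot> (k \<rhd> assoc B h g f)) \<cdot> assoc B k (h \<odot> g) f \<cdot> (assoc B k h g \<lhd> f) \<cdot> ?z"
    unfolding pent[symmetric] using assms by simp
  also have "?y \<cdot> (k \<rhd> assoc B h g f) = id2 B (k \<odot> ((h \<odot> g) \<odot> f))"
    using assms by (simp add: lwhisker_vcomp)
  finally show ?thesis
    using assms by simp
qed

text \<open>Writing \<open>runit B g \<lhd> f\<close> as the other side of the triangle makes
  everything cancel against the inverses that follow.\<close>

lemma inv_triangle:
  assumes "g \<in> Mor B" "f \<in> Mor B" "src B g = trg B f" "b = src B g"
  shows "(runit B g \<lhd> f) \<cdot> inv2 B (assoc B g (id1 B b) f) \<cdot> (g \<rhd> inv2 B (lunit B f)) = id2 B (g \<odot> f)"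
proof -
  have tri: "(g \<rhd> lunit B f) \<cdot> assoc B g (id1 B b) f = runit B g \<lhd> f"
    using assms by (intro triangle[of g b "trg B g" f "src B f"]) (auto simp: in_Mors)
  show ?thesis
    using assms by (simp add: lwhisker_vcomp flip: tri)
qed

end


section \<open>Adjunctions and functors\<close>

text \<open>Transposition is injective: by naturality of the counit and the left triangle identity,
  an arrow \<xi> out of \<open>on_ob L x\<close> is recovered from its transpose as
  \<open>\<epsilon> y\<close> after \<open>on_ar L\<close> of that transpose.\<close>

lemma adjunction_arrow_eqI:
  assumes "adjunction A B L R \<eta> \<epsilon>" and "x \<in> Ob A"
    and "\<phi> \<in> Arr B (on_ob L x) y" "\<psi> \<in> Arr B (on_ob L x) y"
    and eq: "on_ar R \<phi> \<bullet>\<^bsub>A\<^esub> \<eta> x = on_ar R \<psi> \<bullet>\<^bsub>A\<^esub> \<eta> x"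
  shows "\<phi> = \<psi>"
proof -
  interpret adjunction A B L R \<eta> \<epsilon> by fact
  have "\<xi> = \<epsilon> y \<bullet>\<^bsub>B\<^esub> on_ar L (on_ar R \<xi> \<bullet>\<^bsub>A\<^esub> \<eta> x)" if \<xi>: "\<xi> \<in> Arr B (on_ob L x) y" for \<xi>
  proof -
    let ?Lx = "on_ob L x"
    have y: "y \<in> Ob B" and Lx: "?Lx \<in> Ob B"
      using \<xi> L.B.Cod_closed L.on_ob_closed[OF assms(2)] by (auto simp: Arr_def)
    have \<eta>x: "\<eta> x \<in> Arr A x (on_ob R ?Lx)"
      using unit.component[OF assms(2)] by (simp add: id_fctr_def comp_fctr_def)
    have \<epsilon>y: "\<epsilon> z \<in> Arr B (on_ob L (on_ob R z)) z" if "z \<in> Ob B" for z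
      using counit.component[OF that] by (simp add: id_fctr_def comp_fctr_def)
    have R\<xi>: "on_ar R \<xi> \<in> Arr A (on_ob R ?Lx) (on_ob R y)"
      using R.on_ar_closed[OF \<xi>] .
    have nat: "\<xi> \<bullet>\<^bsub>B\<^esub> \<epsilon> ?Lx = \<epsilon> y \<bullet>\<^bsub>B\<^esub> on_ar L (on_ar R \<xi>)"
      using counit.naturality[OF \<xi>] by (simp add: id_fctr_def comp_fctr_def)
    have "\<epsilon> y \<bullet>\<^bsub>B\<^esub> on_ar L (on_ar R \<xi> \<bullet>\<^bsub>A\<^esub> \<eta> x) = \<epsilon> y \<bullet>\<^bsub>B\<^esub> on_ar L (on_ar R \<xi>) \<bullet>\<^bsub>B\<^esub> on_ar L (\<eta> x)"
      using L.on_ar_Cmp[OF R\<xi> \<eta>x] by simp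
    also have "\<dots> = (\<epsilon> y \<bullet>\<^bsub>B\<^esub> on_ar L (on_ar R \<xi>)) \<bullet>\<^bsub>B\<^esub> on_ar L (\<eta> x)"
      using L.B.Cmp_assoc[OF \<epsilon>y[OF y] L.on_ar_closed[OF R\<xi>] L.on_ar_closed[OF \<eta>x]] by simp
    also have "\<dots> = \<xi> \<bullet>\<^bsub>B\<^esub> \<epsilon> ?Lx \<bullet>\<^bsub>B\<^esub> on_ar L (\<eta> x)"
      using L.B.Cmp_assoc[OF \<xi> \<epsilon>y[OF Lx] L.on_ar_closed[OF \<eta>x]] nat by simp
    also have "\<dots> = \<xi>"
      using triangle_left[OF assms(2)] L.B.Cmp_Idn_right[OF \<xi>] by simp
    finally show ?thesis by simp
  qed
  from this[OF assms(3)] this[OF assms(4)] eq show ?thesis by simp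
qed

text \<open>Transposition is surjective, with an explicit preimage of \<open>k\<close>; this is
  naturality of the unit followed by the right triangle identity.\<close>

lemma adjunction_transpose:
  assumes "adjunction A B L R \<eta> \<epsilon>" and "x \<in> Ob A" "y \<in> Ob B" "k \<in> Arr A x (on_ob R y)"
  shows "on_ar R (\<epsilon> y \<bullet>\<^bsub>B\<^esub> on_ar L k) \<bullet>\<^bsub>A\<^esub> \<eta> x = k"
proof -
  interpret adjunction A B L R \<eta> \<epsilon> by fact
  have \<epsilon>y: "\<epsilon> y \<in> Arr B (on_ob L (on_ob R y)) y"
    using counit.component[OF assms(3)] by (simp add: id_fctr_def comp_fctr_def)
  have \<eta>z: "\<eta> z \<in> Arr A z (on_ob R (on_ob L z))" if "z \<in> Ob A" for z
    using unit.component[OF that] by (simp add: id_fctr_def comp_fctr_def)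
  have Lk: "on_ar L k \<in> Arr B (on_ob L x) (on_ob L (on_ob R y))"
    using L.on_ar_closed[OF assms(4)] .
  have nat: "on_ar R (on_ar L k) \<bullet>\<^bsub>A\<^esub> \<eta> x = \<eta> (on_ob R y) \<bullet>\<^bsub>A\<^esub> k"
    using unit.naturality[OF assms(4)] by (simp add: id_fctr_def comp_fctr_def)
  have "on_ar R (\<epsilon> y \<bullet>\<^bsub>B\<^esub> on_ar L k) \<bullet>\<^bsub>A\<^esub> \<eta> x = on_ar R (\<epsilon> y) \<bullet>\<^bsub>A\<^esub> on_ar R (on_ar L k) \<bullet>\<^bsub>A\<^esub> \<eta> x"
    using R.on_ar_Cmp[OF \<epsilon>y Lk]
      L.A.Cmp_assoc[OF R.on_ar_closed[OF \<epsilon>y] R.on_ar_closed[OF Lk] \<eta>z[OF assms(2)]] by simp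
  also have "\<dots> = (on_ar R (\<epsilon> y) \<bullet>\<^bsub>A\<^esub> \<eta> (on_ob R y)) \<bullet>\<^bsub>A\<^esub> k"
    using L.A.Cmp_assoc[OF R.on_ar_closed[OF \<epsilon>y] \<eta>z[OF R.on_ob_closed[OF assms(3)]] assms(4)] nat
    by simp
  also have "\<dots> = k"
    using triangle_right[OF assms(3)] L.A.Cmp_Idn_left[OF assms(4)] by simp
  finally show "on_ar R (\<epsilon> y \<bullet>\<^bsub>B\<^esub> on_ar L k) \<bullet>\<^bsub>A\<^esub> \<eta> x = k" .
qed

lemma cat_functor_is_iso:
  assumes "cat_functor A B F" "is_iso A u"
  shows "is_iso B (on_ar F u)"
proof -
  interpret cat_functor A B F by fact
  let ?x = "Dom A u" and ?y = "Cod A u"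
  from assms(2) obtain v where u: "u \<in> Arr A ?x ?y" and v: "v \<in> Arr A ?y ?x"
    and vu: "v \<bullet>\<^bsub>A\<^esub> u = Idn A ?x" "u \<bullet>\<^bsub>A\<^esub> v = Idn A ?y"
    by (auto simp: is_iso_def Arr_def)
  have xy: "?x \<in> Ob A" "?y \<in> Ob A"
    using u A.Dom_closed A.Cod_closed by (auto simp: Arr_def)
  have Fu: "Dom B (on_ar F u) = on_ob F ?x" "Cod B (on_ar F u) = on_ob F ?y" "on_ar F u \<in> Ar B"
    using on_ar_closed[OF u] by (auto simp: Arr_def)
  show ?thesis
    unfolding is_iso_def Fu
    using Fu(3) on_ar_closed[OF v] on_ar_Cmp[OF v u] on_ar_Cmp[OF u v] on_ar_Idn xy vu
    by auto
qed

lemma comp_fctr_functor: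
  assumes "cat_functor A B F" "cat_functor B C G"
  shows "cat_functor A C (comp_fctr G F)"
proof -
  interpret F: cat_functor A B F by fact
  interpret G: cat_functor B C G by fact
  show ?thesis
    by unfold_locales
      (auto simp: comp_fctr_def F.on_ob_closed G.on_ob_closed F.on_ar_closed G.on_ar_closed
        F.on_ar_Idn G.on_ar_Idn F.on_ar_Cmp[THEN arg_cong] intro: G.on_ar_Cmp F.on_ar_closed)
qed

lemma (in bicategory) invertible_is_iso:
  "\<lbrakk>invertible B \<alpha>; src2 B \<alpha> \<in> Mors B a b\<rbrakk> \<Longrightarrow> is_iso (hom B a b) \<alpha>"
  by (auto simp: invertible_def in_Mors)

section \<open>Pseudofunctors\<close>

context pseudofunctor
begin

lemma obj_P [simp]: "a \<in> Obj C \<Longrightarrow> psf_obj P a \<in> Obj D"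
  by (rule psf_obj_closed)

lemma functor_P:
  "f \<in> Mor C \<Longrightarrow> cat_functor (hom C (src C f) (trg C f))
     (hom D (psf_obj P (src C f)) (psf_obj P (trg C f))) \<lparr>on_ob = psf_mor P, on_ar = psf_cell P\<rparr>"
  by (simp add: psf_hom)

lemma mor_P [simp]:
  assumes "f \<in> Mor C"
  shows "psf_mor P f \<in> Mor D" "src D (psf_mor P f) = psf_obj P (src C f)"
    "trg D (psf_mor P f) = psf_obj P (trg C f)"
  using cat_functor.on_ob_closed[OF functor_P[OF assms], of f] assms by (auto simp: in_Mors)

lemma cell_P [simp]:
  assumes "\<alpha> \<in> Cell C"
  shows "psf_cell P \<alpha> \<in> Cell D" "src2 D (psf_cell P \<alpha>) = psf_mor P (src2 C \<alpha>)"
    "trg2 D (psf_cell P \<alpha>) = psf_mor P (trg2 C \<alpha>)"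
  using cat_functor.on_ar_closed[OF functor_P[of "src2 C \<alpha>"], of \<alpha> "src2 C \<alpha>" "trg2 C \<alpha>"] assms
  by (auto simp: in_Mors in_Arr_hom)

lemma id2_P [simp]: "f \<in> Mor C \<Longrightarrow> psf_cell P (id2 C f) = id2 D (psf_mor P f)"
  using cat_functor.on_ar_Idn[OF functor_P[of f], of f] by (auto simp: in_Mors)

lemma vcomp_P:
  assumes "\<beta> \<in> Cell C" "\<alpha> \<in> Cell C" "src2 C \<beta> = trg2 C \<alpha>"
  shows "psf_cell P \<beta> \<cdot>\<^bsub>D\<^esub> psf_cell P \<alpha> = psf_cell P (\<beta> \<cdot>\<^bsub>C\<^esub> \<alpha>)"
  using cat_functor.on_ar_Cmp[OF functor_P[of "src2 C \<alpha>"], of \<beta> "trg2 C \<alpha>" "trg2 C \<beta>" \<alpha> "src2 C \<alpha>"]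
    assms C.src_parallel[of \<beta>] C.trg_parallel[of \<beta>]
  by (auto simp: in_Mors in_Arr_hom)

lemma invertible_P [simp]:
  assumes "invertible C \<alpha>"
  shows "invertible D (psf_cell P \<alpha>)"
  using cat_functor_is_iso[OF functor_P[of "src2 C \<alpha>"], of \<alpha>] C.invertible_Cell[OF assms]
    C.invertible_is_iso[OF assms] D.is_iso_invertible
  by (auto simp: in_Mors)

section \<open>Compositor and unitor of a pseudofunctor\<close>

lemma comp_P [simp]:
  assumes "g \<in> Mor C" "f \<in> Mor C" "src C g = trg C f"
  shows "psf_comp P g f \<in> Cell D" "src2 D (psf_comp P g f) = psf_mor P g \<odot>\<^bsub>D\<^esub> psf_mor P f"
    "trg2 D (psf_comp P g f) = psf_mor P (g \<odot>\<^bsub>C\<^esub> f)" "invertible D (psf_comp P g f)"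
  using psf_comp_closed[of g "src C g" "trg C g" f "src C f"]
    psf_comp_invertible[of g "src C g" "trg C g" f "src C f"] assms
  by (auto simp: in_Mors in_Cells)

lemma comp_P_nat:
  assumes "\<beta> \<in> Cell C" "\<alpha> \<in> Cell C" "src C (src2 C \<beta>) = trg C (src2 C \<alpha>)"
    "g = src2 C \<beta>" "f = src2 C \<alpha>" "g' = trg2 C \<beta>" "f' = trg2 C \<alpha>"
  shows "psf_cell P (\<beta> \<star>\<^bsub>C\<^esub> \<alpha>) \<cdot>\<^bsub>D\<^esub> psf_comp P g f
      = psf_comp P g' f' \<cdot>\<^bsub>D\<^esub> (psf_cell P \<beta> \<star>\<^bsub>D\<^esub> psf_cell P \<alpha>)"
  using psf_comp_natural[of g "src C g" "trg C g" f "src C f" \<beta> g' \<alpha> f'] assms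
  by (auto simp: in_Mors in_Cells)

text \<open>The multiplication \<open>mu_cell\<close> contains the inverse compositor, so naturality
  is needed in conjugated form.\<close>

lemma inv_comp_P_nat:
  assumes "\<beta> \<in> Cell C" "\<alpha> \<in> Cell C" "src C (src2 C \<beta>) = trg C (src2 C \<alpha>)"
    "g = src2 C \<beta>" "f = src2 C \<alpha>" "g' = trg2 C \<beta>" "f' = trg2 C \<alpha>"
  shows "inv2 D (psf_comp P g' f') \<cdot>\<^bsub>D\<^esub> psf_cell P (\<beta> \<star>\<^bsub>C\<^esub> \<alpha>)
      = (psf_cell P \<beta> \<star>\<^bsub>D\<^esub> psf_cell P \<alpha>) \<cdot>\<^bsub>D\<^esub> inv2 D (psf_comp P g f)"
proof -
  let ?\<gamma> = "psf_comp P g f" and ?\<gamma>' = "psf_comp P g' f'"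
  have "inv2 D ?\<gamma>' \<cdot>\<^bsub>D\<^esub> psf_cell P (\<beta> \<star>\<^bsub>C\<^esub> \<alpha>)
      = inv2 D ?\<gamma>' \<cdot>\<^bsub>D\<^esub> (psf_cell P (\<beta> \<star>\<^bsub>C\<^esub> \<alpha>) \<cdot>\<^bsub>D\<^esub> ?\<gamma>) \<cdot>\<^bsub>D\<^esub> inv2 D ?\<gamma>"
    using assms by simp
  also have "\<dots> = (psf_cell P \<beta> \<star>\<^bsub>D\<^esub> psf_cell P \<alpha>) \<cdot>\<^bsub>D\<^esub> inv2 D ?\<gamma>"
    unfolding comp_P_nat[OF assms] using assms by simp
  finally show ?thesis .
qed

lemma id_P [simp]:
  assumes "a \<in> Obj C"
  shows "psf_id P a \<in> Cell D" "src2 D (psf_id P a) = id1 D (psf_obj P a)"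
    "trg2 D (psf_id P a) = psf_mor P (id1 C a)" "invertible D (psf_id P a)"
  using psf_id_closed psf_id_invertible assms by (auto simp: in_Cells)

lemma assoc_P:
  assumes "h \<in> Mor C" "g \<in> Mor C" "f \<in> Mor C" "src C h = trg C g" "src C g = trg C f"
  shows "psf_cell P (assoc C h g f) \<cdot>\<^bsub>D\<^esub> psf_comp P (h \<odot>\<^bsub>C\<^esub> g) f \<cdot>\<^bsub>D\<^esub> (psf_comp P h g \<lhd>\<^bsub>D\<^esub> psf_mor P f)
    = psf_comp P h (g \<odot>\<^bsub>C\<^esub> f) \<cdot>\<^bsub>D\<^esub> (psf_mor P h \<rhd>\<^bsub>D\<^esub> psf_comp P g f)
      \<cdot>\<^bsub>D\<^esub> assoc D (psf_mor P h) (psf_mor P g) (psf_mor P f)"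
  using psf_assoc[of h "src C h" "trg C h" g "src C g" f "src C f"] assms by (auto simp: in_Mors)

lemma runit_P:
  assumes "f \<in> Mor C" "a = src C f"
  shows "psf_cell P (runit C f) \<cdot>\<^bsub>D\<^esub> psf_comp P f (id1 C a) \<cdot>\<^bsub>D\<^esub> (psf_mor P f \<rhd>\<^bsub>D\<^esub> psf_id P a)
    = runit D (psf_mor P f)"
  using psf_runit[of f a "trg C f"] assms by (auto simp: in_Mors)


text \<open>The associativity axiom with all compositors moved to the other side and inverted, which
  is the direction in which they occur in \<open>mu_cell\<close>.\<close>

lemma inv_assoc_P:
  assumes "h \<in> Mor C" "g \<in> Mor C" "f \<in> Mor C" "src C h = trg C g" "src C g = trg C f"
  shows "(psf_mor P h \<rhd>\<^bsub>D\<^esub> inv2 D (psf_comp P g f)) \<cdot>\<^bsub>D\<^esub> inv2 D (psf_comp P h (g \<odot>\<^bsub>C\<^esub> f))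
      \<cdot>\<^bsub>D\<^esub> psf_cell P (assoc C h g f)
    = assoc D (psf_mor P h) (psf_mor P g) (psf_mor P f) \<cdot>\<^bsub>D\<^esub> (inv2 D (psf_comp P h g) \<lhd>\<^bsub>D\<^esub> psf_mor P f)
      \<cdot>\<^bsub>D\<^esub> inv2 D (psf_comp P (h \<odot>\<^bsub>C\<^esub> g) f)"
proof -
  let ?Ph = "psf_mor P h" and ?Pf = "psf_mor P f"
  let ?x = "psf_comp P h (g \<odot>\<^bsub>C\<^esub> f)" and ?y = "psf_comp P g f" and ?z = "psf_comp P (h \<odot>\<^bsub>C\<^esub> g) f"
    and ?w = "psf_comp P h g" and ?A = "psf_cell P (assoc C h g f)"
    and ?a = "assoc D (psf_mor P h) (psf_mor P g) (psf_mor P f)"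
  note [simp] = assms
  \<comment> \<open>Whiskering preserves inverse pairs; these two identities serve to insert and to
    cancel compositors.\<close>
  have w: "(?w \<lhd>\<^bsub>D\<^esub> ?Pf) \<cdot>\<^bsub>D\<^esub> (inv2 D ?w \<lhd>\<^bsub>D\<^esub> ?Pf) = id2 D (psf_mor P (h \<odot>\<^bsub>C\<^esub> g) \<odot>\<^bsub>D\<^esub> ?Pf)"
    and y: "(?Ph \<rhd>\<^bsub>D\<^esub> inv2 D ?y) \<cdot>\<^bsub>D\<^esub> (?Ph \<rhd>\<^bsub>D\<^esub> ?y) = id2 D (?Ph \<odot>\<^bsub>D\<^esub> psf_mor P g \<odot>\<^bsub>D\<^esub> ?Pf)"
    by (simp_all add: D.rwhisker_vcomp D.lwhisker_vcomp)
  \<comment> \<open>The inserted factors compose to an identity, and they complete \<open>?A\<close>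
    to the left side of the associativity axiom.\<close>
  have "?A = ?A \<cdot>\<^bsub>D\<^esub> ?z \<cdot>\<^bsub>D\<^esub> (?w \<lhd>\<^bsub>D\<^esub> ?Pf) \<cdot>\<^bsub>D\<^esub> (inv2 D ?w \<lhd>\<^bsub>D\<^esub> ?Pf) \<cdot>\<^bsub>D\<^esub> inv2 D ?z"
    by (subst D.vcomp_eq_extend1[OF w]) simp_all
  also have "\<dots> = (?A \<cdot>\<^bsub>D\<^esub> ?z \<cdot>\<^bsub>D\<^esub> (?w \<lhd>\<^bsub>D\<^esub> ?Pf)) \<cdot>\<^bsub>D\<^esub> (inv2 D ?w \<lhd>\<^bsub>D\<^esub> ?Pf) \<cdot>\<^bsub>D\<^esub> inv2 D ?z"
    by simp
  also have "\<dots> = ?x \<cdot>\<^bsub>D\<^esub> (?Ph \<rhd>\<^bsub>D\<^esub> ?y) \<cdot>\<^bsub>D\<^esub> ?a \<cdot>\<^bsub>D\<^esub> (inv2 D ?w \<lhd>\<^bsub>D\<^esub> ?Pf) \<cdot>\<^bsub>D\<^esub> inv2 D ?z"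
    by (subst assoc_P) simp_all
  finally have "(?Ph \<rhd>\<^bsub>D\<^esub> inv2 D ?y) \<cdot>\<^bsub>D\<^esub> inv2 D ?x \<cdot>\<^bsub>D\<^esub> ?A
      = (?Ph \<rhd>\<^bsub>D\<^esub> inv2 D ?y) \<cdot>\<^bsub>D\<^esub> inv2 D ?x \<cdot>\<^bsub>D\<^esub> ?x
        \<cdot>\<^bsub>D\<^esub> (?Ph \<rhd>\<^bsub>D\<^esub> ?y) \<cdot>\<^bsub>D\<^esub> ?a \<cdot>\<^bsub>D\<^esub> (inv2 D ?w \<lhd>\<^bsub>D\<^esub> ?Pf) \<cdot>\<^bsub>D\<^esub> inv2 D ?z"
    by (rule arg_cong)
  also have "\<dots> = (?Ph \<rhd>\<^bsub>D\<^esub> inv2 D ?y) \<cdot>\<^bsub>D\<^esub> (?Ph \<rhd>\<^bsub>D\<^esub> ?y) \<cdot>\<^bsub>D\<^esub> ?a \<cdot>\<^bsub>D\<^esub> (inv2 D ?w \<lhd>\<^bsub>D\<^esub> ?Pf) \<cdot>\<^bsub>D\<^esub> inv2 D ?z"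
    by simp
  also have "\<dots> = ?a \<cdot>\<^bsub>D\<^esub> (inv2 D ?w \<lhd>\<^bsub>D\<^esub> ?Pf) \<cdot>\<^bsub>D\<^esub> inv2 D ?z"
    by (subst D.vcomp_eq_extend1[OF y]) simp_all
  finally show ?thesis .
qed

text \<open>The right unit axiom composed on the right with the inverses of the whiskered unitor and
  of the compositor.\<close>

lemma inv_runit_P:
  assumes "f \<in> Mor C" "a = src C f"
  shows "runit D (psf_mor P f) \<cdot>\<^bsub>D\<^esub> (psf_mor P f \<rhd>\<^bsub>D\<^esub> inv2 D (psf_id P a)) \<cdot>\<^bsub>D\<^esub> inv2 D (psf_comp P f (id1 C a))
    = psf_cell P (runit C f)"
proof -
  let ?f = "psf_mor P f" and ?\<iota> = "psf_id P a" and ?\<gamma> = "psf_comp P f (id1 C a)"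
  note [simp] = assms
  have eq: "(?f \<rhd>\<^bsub>D\<^esub> ?\<iota>) \<cdot>\<^bsub>D\<^esub> (?f \<rhd>\<^bsub>D\<^esub> inv2 D ?\<iota>) = id2 D (?f \<odot>\<^bsub>D\<^esub> psf_mor P (id1 C a))"
    by (simp add: D.lwhisker_vcomp)
  have "runit D ?f \<cdot>\<^bsub>D\<^esub> (?f \<rhd>\<^bsub>D\<^esub> inv2 D ?\<iota>) \<cdot>\<^bsub>D\<^esub> inv2 D ?\<gamma>
    = psf_cell P (runit C f) \<cdot>\<^bsub>D\<^esub> ?\<gamma> \<cdot>\<^bsub>D\<^esub> (?f \<rhd>\<^bsub>D\<^esub> ?\<iota>) \<cdot>\<^bsub>D\<^esub> (?f \<rhd>\<^bsub>D\<^esub> inv2 D ?\<iota>) \<cdot>\<^bsub>D\<^esub> inv2 D ?\<gamma>"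
    by (subst runit_P[OF assms, symmetric]) simp
  also have "\<dots> = psf_cell P (runit C f)"
    by (subst D.vcomp_eq_extend1[OF eq]) simp_all
  finally show ?thesis .
qed

end

section \<open>Transposition along a relative pseudoadjunction\<close>

context relative_pseudoadjunction
begin

section \<open>The functor \<open>sharp\<close>, the unit, the counit and transposes\<close>

abbreviation sharp :: "'oc \<Rightarrow> 'oe \<Rightarrow> 'md \<Rightarrow> 'me" where
  "sharp X A \<equiv> on_ob (rpa_sharp F X A)"

abbreviation sharp2 :: "'oc \<Rightarrow> 'oe \<Rightarrow> 'cd \<Rightarrow> 'ce" where
  "sharp2 X A \<equiv> on_ar (rpa_sharp F X A)"

lemma rpa_obj [simp]: "X \<in> Obj C \<Longrightarrow> rpa_obj F X \<in> Obj E"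
  by (rule rpa_obj_closed)

lemma rpa_i [simp]:
  assumes "X \<in> Obj C"
  shows "rpa_i F X \<in> Mor D" "src D (rpa_i F X) = psf_obj J X"
    "trg D (rpa_i F X) = psf_obj G (rpa_obj F X)"
  using rpa_i_closed[OF assms] by (auto simp: in_Mors)

lemma rpa_adjunction:
  "\<lbrakk>X \<in> Obj C; A \<in> Obj E\<rbrakk>
    \<Longrightarrow> adjunction (hom D (psf_obj J X) (psf_obj G A)) (hom E (rpa_obj F X) A)
          (rpa_sharp F X A) (apply_precomp D G (rpa_i F X)) (rpa_unit F X A) (rpa_counit F X A)"
  using rpa_adjoint_equivalence by (simp add: adjoint_equivalence_def)

lemma sharp_functor:
  "\<lbrakk>X \<in> Obj C; A \<in> Obj E\<rbrakk>
    \<Longrightarrow> cat_functor (hom D (psf_obj J X) (psf_obj G A)) (hom E (rpa_obj F X) A) (rpa_sharp F X A)"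
  using rpa_adjunction by (simp add: adjunction_def)

lemma sharp_simps [simp]:
  assumes "X \<in> Obj C" "A \<in> Obj E" "f \<in> Mor D" "src D f = psf_obj J X" "trg D f = psf_obj G A"
  shows "sharp X A f \<in> Mor E" "src E (sharp X A f) = rpa_obj F X" "trg E (sharp X A f) = A"
  using cat_functor.on_ob_closed[OF sharp_functor, of X A f] assms by (auto simp: in_Mors)

lemma sharp2_simps [simp]:
  assumes "X \<in> Obj C" "A \<in> Obj E" "\<alpha> \<in> Cell D"
    "src D (src2 D \<alpha>) = psf_obj J X" "trg D (src2 D \<alpha>) = psf_obj G A"
  shows "sharp2 X A \<alpha> \<in> Cell E" "src2 E (sharp2 X A \<alpha>) = sharp X A (src2 D \<alpha>)"
    "trg2 E (sharp2 X A \<alpha>) = sharp X A (trg2 D \<alpha>)"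
  using cat_functor.on_ar_closed[OF sharp_functor, of X A \<alpha> "src2 D \<alpha>" "trg2 D \<alpha>"] assms
  by (auto simp: in_Mors in_Arr_hom)

lemma sharp2_id2 [simp]:
  assumes "X \<in> Obj C" "A \<in> Obj E" "f \<in> Mor D" "src D f = psf_obj J X" "trg D f = psf_obj G A"
  shows "sharp2 X A (id2 D f) = id2 E (sharp X A f)"
  using cat_functor.on_ar_Idn[OF sharp_functor, of X A f] assms by (auto simp: in_Mors)

lemma sharp2_vcomp:
  assumes "X \<in> Obj C" "A \<in> Obj E" "\<beta> \<in> Cell D" "\<alpha> \<in> Cell D" "src2 D \<beta> = trg2 D \<alpha>"
    "src D (src2 D \<alpha>) = psf_obj J X" "trg D (src2 D \<alpha>) = psf_obj G A"
  shows "sharp2 X A \<beta> \<cdot>\<^bsub>E\<^esub> sharp2 X A \<alpha> = sharp2 X A (\<beta> \<cdot>\<^bsub>D\<^esub> \<alpha>)"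
  using cat_functor.on_ar_Cmp[OF sharp_functor, of X A \<beta> "trg2 D \<alpha>" "trg2 D \<beta>" \<alpha> "src2 D \<alpha>"] assms
    J.D.src_trg2[of \<beta>] J.D.trg_trg2[of \<beta>]
  by (simp add: in_Mors in_Arr_hom)

lemma sharp2_invertible [simp]:
  assumes "X \<in> Obj C" "A \<in> Obj E" "invertible D \<alpha>"
    "src D (src2 D \<alpha>) = psf_obj J X" "trg D (src2 D \<alpha>) = psf_obj G A"
  shows "invertible E (sharp2 X A \<alpha>)"
  using cat_functor_is_iso[OF sharp_functor, of X A \<alpha>] assms J.D.invertible_Cell[OF assms(3)]
    J.D.invertible_is_iso[OF assms(3)] G.C.is_iso_invertible
  by (auto simp: in_Mors)

lemma unit_simps [simp]:
  assumes "X \<in> Obj C" "A \<in> Obj E" "f \<in> Mor D" "src D f = psf_obj J X" "trg D f = psf_obj G A"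
  shows "rpa_unit F X A f \<in> Cell D" "src2 D (rpa_unit F X A f) = f"
    "trg2 D (rpa_unit F X A f) = psf_mor G (sharp X A f) \<odot>\<^bsub>D\<^esub> rpa_i F X"
    "invertible D (rpa_unit F X A f)"
proof -
  interpret ae: adjoint_equivalence "hom D (psf_obj J X) (psf_obj G A)" "hom E (rpa_obj F X) A"
    "rpa_sharp F X A" "apply_precomp D G (rpa_i F X)" "rpa_unit F X A" "rpa_counit F X A"
    using assms by (intro rpa_adjoint_equivalence)
  have f: "f \<in> Mors D (psf_obj J X) (psf_obj G A)"
    using assms by (simp add: in_Mors)
  show "rpa_unit F X A f \<in> Cell D" "src2 D (rpa_unit F X A f) = f"
    "trg2 D (rpa_unit F X A f) = psf_mor G (sharp X A f) \<odot>\<^bsub>D\<^esub> rpa_i F X"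
    using ae.unit.component[of f] f
    by (auto simp: in_Arr_hom apply_precomp_def id_fctr_def comp_fctr_def)
  show "invertible D (rpa_unit F X A f)"
    using ae.unit_iso[of f] f J.D.is_iso_invertible by auto
qed

lemma unit_nat:
  assumes "X \<in> Obj C" "A \<in> Obj E" "\<alpha> \<in> Cell D"
    "src D (src2 D \<alpha>) = psf_obj J X" "trg D (src2 D \<alpha>) = psf_obj G A" "f = src2 D \<alpha>" "f' = trg2 D \<alpha>"
  shows "(psf_cell G (sharp2 X A \<alpha>) \<lhd>\<^bsub>D\<^esub> rpa_i F X) \<cdot>\<^bsub>D\<^esub> rpa_unit F X A f
    = rpa_unit F X A f' \<cdot>\<^bsub>D\<^esub> \<alpha>"
proof -
  interpret adj: adjunction "hom D (psf_obj J X) (psf_obj G A)" "hom E (rpa_obj F X) A"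
    "rpa_sharp F X A" "apply_precomp D G (rpa_i F X)" "rpa_unit F X A" "rpa_counit F X A"
    using assms by (intro rpa_adjunction)
  show ?thesis
    using adj.unit.naturality[of \<alpha> f f'] assms
    by (auto simp: in_Arr_hom in_Mors apply_precomp_def id_fctr_def comp_fctr_def)
qed

lemma counit_simps:
  assumes "X \<in> Obj C" "u \<in> Mor E" "src E u = rpa_obj F X" "A = trg E u"
  shows "rpa_counit F X A u \<in> Cell E"
    "src2 E (rpa_counit F X A u) = sharp X A (psf_mor G u \<odot>\<^bsub>D\<^esub> rpa_i F X)"
    "trg2 E (rpa_counit F X A u) = u" "invertible E (rpa_counit F X A u)"
proof -
  interpret ae: adjoint_equivalence "hom D (psf_obj J X) (psf_obj G A)" "hom E (rpa_obj F X) A"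
    "rpa_sharp F X A" "apply_precomp D G (rpa_i F X)" "rpa_unit F X A" "rpa_counit F X A"
    using assms by (intro rpa_adjoint_equivalence) auto
  have u: "u \<in> Mors E (rpa_obj F X) A"
    using assms by (simp add: in_Mors)
  show "rpa_counit F X A u \<in> Cell E"
    "src2 E (rpa_counit F X A u) = sharp X A (psf_mor G u \<odot>\<^bsub>D\<^esub> rpa_i F X)"
    "trg2 E (rpa_counit F X A u) = u"
    using ae.counit.component[of u] u
    by (auto simp: in_Arr_hom apply_precomp_def id_fctr_def comp_fctr_def)
  show "invertible E (rpa_counit F X A u)"
    using ae.counit_iso[of u] u G.C.is_iso_invertible by auto
qed

text \<open>The instance of \<open>adjunction_arrow_eqI\<close> that moves identities from
  \<open>E\<close> to \<open>D\<close>; the naturality, associativity and unit laws of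
  \<open>kappa\<close> are all proved through it.\<close>

lemma cell_from_sharp_eqI:
  assumes "X \<in> Obj C" "A \<in> Obj E" "f \<in> Mor D" "src D f = psf_obj J X" "trg D f = psf_obj G A"
    "\<phi> \<in> Cell E" "src2 E \<phi> = sharp X A f" "\<psi> \<in> Cell E" "src2 E \<psi> = sharp X A f" "trg2 E \<phi> = trg2 E \<psi>"
    "(psf_cell G \<phi> \<lhd>\<^bsub>D\<^esub> rpa_i F X) \<cdot>\<^bsub>D\<^esub> rpa_unit F X A f
      = (psf_cell G \<psi> \<lhd>\<^bsub>D\<^esub> rpa_i F X) \<cdot>\<^bsub>D\<^esub> rpa_unit F X A f"
  shows "\<phi> = \<psi>"
  using adjunction_arrow_eqI[OF rpa_adjunction[OF assms(1,2)], of f \<phi> "trg2 E \<psi>" \<psi>] assms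
    G.C.src_parallel[of \<psi>] G.C.trg_parallel[of \<psi>]
  by (simp add: in_Arr_hom in_Mors apply_precomp_def)

definition transp :: "'oc \<Rightarrow> 'me \<Rightarrow> 'cd \<Rightarrow> 'ce" where
  "transp X u k = rpa_counit F X (trg E u) u \<cdot>\<^bsub>E\<^esub> sharp2 X (trg E u) k"

text \<open>Invertibility passes from \<open>k\<close> to its transpose because
  \<open>sharp2\<close> preserves it and the counit is invertible.\<close>

lemma transp_simps [simp]:
  assumes "X \<in> Obj C" "u \<in> Mor E" "src E u = rpa_obj F X"
    "k \<in> Cell D" "trg2 D k = psf_mor G u \<odot>\<^bsub>D\<^esub> rpa_i F X"
  shows "transp X u k \<in> Cell E" "src2 E (transp X u k) = sharp X (trg E u) (src2 D k)"
    "trg2 E (transp X u k) = u" "invertible D k \<Longrightarrow> invertible E (transp X u k)"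
proof -
  have "src D (src2 D k) = psf_obj J X" "trg D (src2 D k) = psf_obj G (trg E u)"
    using assms J.D.src_parallel[of k] J.D.trg_parallel[of k] by simp_all
  then show "transp X u k \<in> Cell E" "src2 E (transp X u k) = sharp X (trg E u) (src2 D k)"
    "trg2 E (transp X u k) = u" "invertible D k \<Longrightarrow> invertible E (transp X u k)"
    using assms by (simp_all add: transp_def counit_simps)
qed

lemma transp_unit:
  assumes "X \<in> Obj C" "u \<in> Mor E" "src E u = rpa_obj F X" "A = trg E u"
    "k \<in> Cell D" "trg2 D k = psf_mor G u \<odot>\<^bsub>D\<^esub> rpa_i F X" "f = src2 D k"
  shows "(psf_cell G (transp X u k) \<lhd>\<^bsub>D\<^esub> rpa_i F X) \<cdot>\<^bsub>D\<^esub> rpa_unit F X A f = k"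
proof -
  have "src D f = psf_obj J X" "trg D f = psf_obj G A"
    using assms J.D.src_parallel[of k] J.D.trg_parallel[of k] by simp_all
  then show ?thesis
    using adjunction_transpose[OF rpa_adjunction, of X A f u k] assms
    by (simp add: in_Arr_hom in_Mors apply_precomp_def transp_def)
qed

section \<open>The comparison \<open>kappa\<close> and its transpose \<open>kcell\<close>\<close>

definition kcell :: "'oc \<Rightarrow> 'me \<Rightarrow> 'md \<Rightarrow> 'cd" where
  "kcell X u f = (psf_comp G u (sharp X (src E u) f) \<lhd>\<^bsub>D\<^esub> rpa_i F X)
    \<cdot>\<^bsub>D\<^esub> inv2 D (assoc D (psf_mor G u) (psf_mor G (sharp X (src E u) f)) (rpa_i F X))
    \<cdot>\<^bsub>D\<^esub> (psf_mor G u \<rhd>\<^bsub>D\<^esub> rpa_unit F X (src E u) f)"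

definition kappa :: "'oc \<Rightarrow> 'me \<Rightarrow> 'md \<Rightarrow> 'ce" where
  "kappa X u f = transp X (u \<odot>\<^bsub>E\<^esub> sharp X (src E u) f) (kcell X u f)"

text \<open>All three factors of \<open>kcell\<close> are invertible; for the last one this is
  invertibility of the unit of the adjoint equivalence.\<close>

lemma kcell_simps [simp]:
  assumes "X \<in> Obj C" "u \<in> Mor E" "f \<in> Mor D" "src D f = psf_obj J X" "trg D f = psf_obj G (src E u)"
  shows "kcell X u f \<in> Cell D" "src2 D (kcell X u f) = psf_mor G u \<odot>\<^bsub>D\<^esub> f"
    "trg2 D (kcell X u f) = psf_mor G (u \<odot>\<^bsub>E\<^esub> sharp X (src E u) f) \<odot>\<^bsub>D\<^esub> rpa_i F X"
    "invertible D (kcell X u f)"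
  using assms by (simp_all add: kcell_def)

lemma kappa_simps [simp]:
  assumes "X \<in> Obj C" "u \<in> Mor E" "f \<in> Mor D" "src D f = psf_obj J X" "trg D f = psf_obj G (src E u)"
  shows "kappa X u f \<in> Cell E" "src2 E (kappa X u f) = sharp X (trg E u) (psf_mor G u \<odot>\<^bsub>D\<^esub> f)"
    "trg2 E (kappa X u f) = u \<odot>\<^bsub>E\<^esub> sharp X (src E u) f" "invertible E (kappa X u f)"
  using assms by (simp_all add: kappa_def)

lemma kappa_unit:
  assumes "X \<in> Obj C" "u \<in> Mor E" "f \<in> Mor D" "src D f = psf_obj J X" "trg D f = psf_obj G (src E u)"
    "A = trg E u" "f' = psf_mor G u \<odot>\<^bsub>D\<^esub> f"
  shows "(psf_cell G (kappa X u f) \<lhd>\<^bsub>D\<^esub> rpa_i F X) \<cdot>\<^bsub>D\<^esub> rpa_unit F X A f' = kcell X u f"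
  unfolding kappa_def using assms by (intro transp_unit) simp_all

lemma G_rwhisker_vcomp:
  assumes "\<psi> \<in> Cell E" "\<phi> \<in> Cell E" "src2 E \<psi> = trg2 E \<phi>" "f \<in> Mor D"
    "trg D f = psf_obj G (src E (src2 E \<phi>))"
  shows "(psf_cell G \<psi> \<lhd>\<^bsub>D\<^esub> f) \<cdot>\<^bsub>D\<^esub> (psf_cell G \<phi> \<lhd>\<^bsub>D\<^esub> f) = psf_cell G (\<psi> \<cdot>\<^bsub>E\<^esub> \<phi>) \<lhd>\<^bsub>D\<^esub> f"
  using assms by (simp add: J.D.rwhisker_vcomp G.vcomp_P)

text \<open>Transposition turns a composite \<open>\<psi> \<cdot> \<kappa> \<cdot> \<alpha>\<^sup>\<sharp>\<close> into \<open>(G \<psi> \<lhd> i) \<cdot> k \<cdot> \<alpha>\<close>, which reduces every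
  identity between such composites to a calculation in \<open>D\<close>.\<close>

lemma transpose_kappa_sharp2:
  assumes "X \<in> Obj C" "u \<in> Mor E" "f \<in> Mor D" "src D f = psf_obj J X" "trg D f = psf_obj G (src E u)"
    "\<alpha> \<in> Cell D" "trg2 D \<alpha> = psf_mor G u \<odot>\<^bsub>D\<^esub> f" "\<psi> \<in> Cell E" "src2 E \<psi> = u \<odot>\<^bsub>E\<^esub> sharp X (src E u) f"
    "B = trg E u" "h = src2 D \<alpha>"
  shows "(psf_cell G (\<psi> \<cdot>\<^bsub>E\<^esub> kappa X u f \<cdot>\<^bsub>E\<^esub> sharp2 X B \<alpha>) \<lhd>\<^bsub>D\<^esub> rpa_i F X) \<cdot>\<^bsub>D\<^esub> rpa_unit F X B h
    = (psf_cell G \<psi> \<lhd>\<^bsub>D\<^esub> rpa_i F X) \<cdot>\<^bsub>D\<^esub> kcell X u f \<cdot>\<^bsub>D\<^esub> \<alpha>"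
proof -
  let ?i = "rpa_i F X"
  have h: "src D h = psf_obj J X" "trg D h = psf_obj G B" "h \<in> Mor D"
    using assms J.D.src_parallel[of \<alpha>] J.D.trg_parallel[of \<alpha>] by simp_all
  have "(psf_cell G (\<psi> \<cdot>\<^bsub>E\<^esub> kappa X u f \<cdot>\<^bsub>E\<^esub> sharp2 X B \<alpha>) \<lhd>\<^bsub>D\<^esub> ?i) \<cdot>\<^bsub>D\<^esub> rpa_unit F X B h
     = (psf_cell G \<psi> \<lhd>\<^bsub>D\<^esub> ?i) \<cdot>\<^bsub>D\<^esub> (psf_cell G (kappa X u f) \<lhd>\<^bsub>D\<^esub> ?i)
        \<cdot>\<^bsub>D\<^esub> (psf_cell G (sharp2 X B \<alpha>) \<lhd>\<^bsub>D\<^esub> ?i) \<cdot>\<^bsub>D\<^esub> rpa_unit F X B h"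
    using assms h by (simp flip: G_rwhisker_vcomp)
  \<comment> \<open>Naturality of the unit moves \<open>\<alpha>\<close> to the far right and leaves
    \<open>kappa\<close> next to the unit at its own source, where \<open>kappa_unit\<close>
    applies.\<close>
  also have "(psf_cell G (sharp2 X B \<alpha>) \<lhd>\<^bsub>D\<^esub> ?i) \<cdot>\<^bsub>D\<^esub> rpa_unit F X B h
      = rpa_unit F X B (psf_mor G u \<odot>\<^bsub>D\<^esub> f) \<cdot>\<^bsub>D\<^esub> \<alpha>"
    using assms h by (intro unit_nat) simp_all
  also have "(psf_cell G (kappa X u f) \<lhd>\<^bsub>D\<^esub> ?i) \<cdot>\<^bsub>D\<^esub> rpa_unit F X B (psf_mor G u \<odot>\<^bsub>D\<^esub> f) \<cdot>\<^bsub>D\<^esub> \<alpha>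
     = kcell X u f \<cdot>\<^bsub>D\<^esub> \<alpha>"
    using assms by (intro J.D.vcomp_eq_extend1 kappa_unit) simp_all
  finally show ?thesis .
qed

text \<open>The common computation behind \<open>kcell_nat\<close> and
  \<open>kcell_lwhisker\<close>. The cell \<open>\<alpha> \<star> \<psi>\<close> slides past the
  compositor and the inverse associator by naturality, and interchange then merges
  \<open>\<psi>\<close> with the unit into its transpose.\<close>

lemma kcell_hcomp:
  assumes "X \<in> Obj C" "\<alpha> \<in> Cell E" "\<psi> \<in> Cell E" "src2 E \<psi> = sharp X A f" "A = src E (src2 E \<alpha>)"
    "f \<in> Mor D" "src D f = psf_obj J X" "trg D f = psf_obj G A"
    "u = src2 E \<alpha>" "u' = trg2 E \<alpha>" "w = trg2 E \<psi>"
  shows "(psf_cell G (\<alpha> \<star>\<^bsub>E\<^esub> \<psi>) \<lhd>\<^bsub>D\<^esub> rpa_i F X) \<cdot>\<^bsub>D\<^esub> kcell X u f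
    = (psf_comp G u' w \<lhd>\<^bsub>D\<^esub> rpa_i F X)
      \<cdot>\<^bsub>D\<^esub> inv2 D (assoc D (psf_mor G u') (psf_mor G w) (rpa_i F X))
      \<cdot>\<^bsub>D\<^esub> (psf_cell G \<alpha> \<star>\<^bsub>D\<^esub> ((psf_cell G \<psi> \<lhd>\<^bsub>D\<^esub> rpa_i F X) \<cdot>\<^bsub>D\<^esub> rpa_unit F X A f))"
proof -
  let ?i = "rpa_i F X" and ?\<eta> = "rpa_unit F X A f"
    and ?\<gamma> = "psf_comp G u (sharp X A f)" and ?\<gamma>' = "psf_comp G u' w"
    and ?a = "assoc D (psf_mor G u) (psf_mor G (sharp X A f)) (rpa_i F X)"
    and ?a' = "assoc D (psf_mor G u') (psf_mor G w) (rpa_i F X)"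
  have [simp]: "src E w = rpa_obj F X" "trg E w = A"
    using assms G.C.src_parallel[of \<psi>] G.C.trg_parallel[of \<psi>] by simp_all
  note [simp] = assms(1-8)
  have 1: "(psf_cell G (\<alpha> \<star>\<^bsub>E\<^esub> \<psi>) \<lhd>\<^bsub>D\<^esub> ?i) \<cdot>\<^bsub>D\<^esub> (?\<gamma> \<lhd>\<^bsub>D\<^esub> ?i)
      = (?\<gamma>' \<lhd>\<^bsub>D\<^esub> ?i) \<cdot>\<^bsub>D\<^esub> ((psf_cell G \<alpha> \<star>\<^bsub>D\<^esub> psf_cell G \<psi>) \<lhd>\<^bsub>D\<^esub> ?i)"
    using assms(9-11) by (simp add: J.D.rwhisker_vcomp G.comp_P_nat[of \<alpha> \<psi>])
  have 2: "((psf_cell G \<alpha> \<star>\<^bsub>D\<^esub> psf_cell G \<psi>) \<lhd>\<^bsub>D\<^esub> ?i) \<cdot>\<^bsub>D\<^esub> inv2 D ?a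
      = inv2 D ?a' \<cdot>\<^bsub>D\<^esub> (psf_cell G \<alpha> \<star>\<^bsub>D\<^esub> (psf_cell G \<psi> \<lhd>\<^bsub>D\<^esub> ?i))"
    using assms(9-11) by (intro J.D.inv_assoc_nat[symmetric]) simp_all
  have 3: "(psf_cell G \<alpha> \<star>\<^bsub>D\<^esub> (psf_cell G \<psi> \<lhd>\<^bsub>D\<^esub> ?i)) \<cdot>\<^bsub>D\<^esub> (psf_mor G u \<rhd>\<^bsub>D\<^esub> ?\<eta>)
     = psf_cell G \<alpha> \<star>\<^bsub>D\<^esub> ((psf_cell G \<psi> \<lhd>\<^bsub>D\<^esub> ?i) \<cdot>\<^bsub>D\<^esub> ?\<eta>)"
    using assms(9-11) by (simp add: J.D.hcomp_vcomp)
  show ?thesis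
    unfolding kcell_def
    using J.D.vcomp_eq_extend[OF 1, of "inv2 D ?a \<cdot>\<^bsub>D\<^esub> (psf_mor G u \<rhd>\<^bsub>D\<^esub> ?\<eta>)"]
      J.D.vcomp_eq_extend[OF 2, of "psf_mor G u \<rhd>\<^bsub>D\<^esub> ?\<eta>"] 3 assms(9-11)
    by simp
qed

text \<open>The case of \<open>kcell_hcomp\<close> in which the right factor is
  \<open>sharp2 X A \<beta>\<close>; its transpose is rewritten by naturality of the unit.\<close>

lemma kcell_nat:
  assumes "X \<in> Obj C" "\<alpha> \<in> Cell E" "\<beta> \<in> Cell D"
    "src D (src2 D \<beta>) = psf_obj J X" "trg D (src2 D \<beta>) = psf_obj G (src E (src2 E \<alpha>))"
    "u = src2 E \<alpha>" "f = src2 D \<beta>" "u' = trg2 E \<alpha>" "f' = trg2 D \<beta>" "A = src E u"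
  shows "(psf_cell G (\<alpha> \<star>\<^bsub>E\<^esub> sharp2 X A \<beta>) \<lhd>\<^bsub>D\<^esub> rpa_i F X) \<cdot>\<^bsub>D\<^esub> kcell X u f
    = kcell X u' f' \<cdot>\<^bsub>D\<^esub> (psf_cell G \<alpha> \<star>\<^bsub>D\<^esub> \<beta>)"
  unfolding kcell_def[of X u']
  using kcell_hcomp[of X \<alpha> "sharp2 X A \<beta>" A f u u' "sharp X A f'"] unit_nat[of X A \<beta> f f'] assms
  by (simp add: J.D.hcomp_vcomp)

lemma kappa_nat:
  assumes "X \<in> Obj C" "\<alpha> \<in> Cell E" "\<beta> \<in> Cell D"
    "src D (src2 D \<beta>) = psf_obj J X" "trg D (src2 D \<beta>) = psf_obj G (src E (src2 E \<alpha>))"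
    "u = src2 E \<alpha>" "f = src2 D \<beta>" "u' = trg2 E \<alpha>" "f' = trg2 D \<beta>" "A = src E u" "B = trg E u"
  shows "(\<alpha> \<star>\<^bsub>E\<^esub> sharp2 X A \<beta>) \<cdot>\<^bsub>E\<^esub> kappa X u f
    = kappa X u' f' \<cdot>\<^bsub>E\<^esub> sharp2 X B (psf_cell G \<alpha> \<star>\<^bsub>D\<^esub> \<beta>)"
proof (rule cell_from_sharp_eqI[of X B "psf_mor G u \<odot>\<^bsub>D\<^esub> f"])
  note [simp] = assms(1-5)
  \<comment> \<open>An identity takes the place of the inner \<open>sharp2\<close> factor here; on
    the other side of the equation an identity takes the place of the outer cell.\<close>
  have "(psf_cell G ((\<alpha> \<star>\<^bsub>E\<^esub> sharp2 X A \<beta>) \<cdot>\<^bsub>E\<^esub> kappa X u f) \<lhd>\<^bsub>D\<^esub> rpa_i F X)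
      \<cdot>\<^bsub>D\<^esub> rpa_unit F X B (psf_mor G u \<odot>\<^bsub>D\<^esub> f)
    = (psf_cell G (\<alpha> \<star>\<^bsub>E\<^esub> sharp2 X A \<beta>) \<lhd>\<^bsub>D\<^esub> rpa_i F X) \<cdot>\<^bsub>D\<^esub> kcell X u f"
    using transpose_kappa_sharp2[of X u f "id2 D (psf_mor G u \<odot>\<^bsub>D\<^esub> f)" "\<alpha> \<star>\<^bsub>E\<^esub> sharp2 X A \<beta>" B]
    by (simp add: assms(6-11))
  also have "\<dots> = kcell X u' f' \<cdot>\<^bsub>D\<^esub> (psf_cell G \<alpha> \<star>\<^bsub>D\<^esub> \<beta>)"
    by (rule kcell_nat) (simp_all add: assms(6-11))
  also have "\<dots> = (psf_cell G (kappa X u' f' \<cdot>\<^bsub>E\<^esub> sharp2 X B (psf_cell G \<alpha> \<star>\<^bsub>D\<^esub> \<beta>)) \<lhd>\<^bsub>D\<^esub> rpa_i F X)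
      \<cdot>\<^bsub>D\<^esub> rpa_unit F X B (psf_mor G u \<odot>\<^bsub>D\<^esub> f)"
    using transpose_kappa_sharp2[of X u' f' "psf_cell G \<alpha> \<star>\<^bsub>D\<^esub> \<beta>" "id2 E (u' \<odot>\<^bsub>E\<^esub> sharp X (src E u') f')" B]
    by (simp add: assms(6-11))
  finally show "(psf_cell G ((\<alpha> \<star>\<^bsub>E\<^esub> sharp2 X A \<beta>) \<cdot>\<^bsub>E\<^esub> kappa X u f) \<lhd>\<^bsub>D\<^esub> rpa_i F X)
      \<cdot>\<^bsub>D\<^esub> rpa_unit F X B (psf_mor G u \<odot>\<^bsub>D\<^esub> f)
    = (psf_cell G (kappa X u' f' \<cdot>\<^bsub>E\<^esub> sharp2 X B (psf_cell G \<alpha> \<star>\<^bsub>D\<^esub> \<beta>)) \<lhd>\<^bsub>D\<^esub> rpa_i F X)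
      \<cdot>\<^bsub>D\<^esub> rpa_unit F X B (psf_mor G u \<odot>\<^bsub>D\<^esub> f)" .
qed (use assms in simp_all)

text \<open>The transpose of \<open>\<psi>\<close> is abstracted to \<open>\<tau>\<close> so that
  the rule can be resolved with \<open>kappa_unit\<close> and
  \<open>theta_cell_unit\<close>.\<close>

lemma kcell_lwhisker:
  assumes "X \<in> Obj C" "v \<in> Mor E" "\<psi> \<in> Cell E" "src2 E \<psi> = sharp X A f" "A = src E v"
    "f \<in> Mor D" "src D f = psf_obj J X" "trg D f = psf_obj G A" "w = trg2 E \<psi>"
    "(psf_cell G \<psi> \<lhd>\<^bsub>D\<^esub> rpa_i F X) \<cdot>\<^bsub>D\<^esub> rpa_unit F X A f = \<tau>"
  shows "(psf_cell G (v \<rhd>\<^bsub>E\<^esub> \<psi>) \<lhd>\<^bsub>D\<^esub> rpa_i F X) \<cdot>\<^bsub>D\<^esub> kcell X v f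
    = (psf_comp G v w \<lhd>\<^bsub>D\<^esub> rpa_i F X)
      \<cdot>\<^bsub>D\<^esub> inv2 D (assoc D (psf_mor G v) (psf_mor G w) (rpa_i F X)) \<cdot>\<^bsub>D\<^esub> (psf_mor G v \<rhd>\<^bsub>D\<^esub> \<tau>)"
proof -
  have "(psf_cell G (v \<rhd>\<^bsub>E\<^esub> \<psi>) \<lhd>\<^bsub>D\<^esub> rpa_i F X) \<cdot>\<^bsub>D\<^esub> kcell X v f
    = (psf_comp G v w \<lhd>\<^bsub>D\<^esub> rpa_i F X)
      \<cdot>\<^bsub>D\<^esub> inv2 D (assoc D (psf_mor G v) (psf_mor G w) (rpa_i F X))
      \<cdot>\<^bsub>D\<^esub> (psf_cell G (id2 E v) \<star>\<^bsub>D\<^esub> ((psf_cell G \<psi> \<lhd>\<^bsub>D\<^esub> rpa_i F X) \<cdot>\<^bsub>D\<^esub> rpa_unit F X A f))"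
    by (rule kcell_hcomp) (simp_all only: assms(1-9) G.C.id2_simps)
  then show ?thesis
    by (simp only: assms(10) G.id2_P[OF assms(2)])
qed
text \<open>The transposed form of \<open>kappa_assoc\<close>. Both sides are brought to a whiskered
  cell followed by \<open>?b\<close> and \<open>?E\<close>; the two whiskered cells are the two
  sides of the associativity axiom of \<open>G\<close>.\<close>

lemma kcell_comp:
  assumes "X \<in> Obj C" "v \<in> Mor E" "u \<in> Mor E" "src E v = trg E u"
    "f \<in> Mor D" "src D f = psf_obj J X" "trg D f = psf_obj G A" "A = src E u"
  shows "(psf_cell G (assoc E v u (sharp X A f)) \<lhd>\<^bsub>D\<^esub> rpa_i F X) \<cdot>\<^bsub>D\<^esub> kcell X (v \<odot>\<^bsub>E\<^esub> u) f
      \<cdot>\<^bsub>D\<^esub> (psf_comp G v u \<lhd>\<^bsub>D\<^esub> f)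
    = (psf_cell G (v \<rhd>\<^bsub>E\<^esub> kappa X u f) \<lhd>\<^bsub>D\<^esub> rpa_i F X) \<cdot>\<^bsub>D\<^esub> kcell X v (psf_mor G u \<odot>\<^bsub>D\<^esub> f)
      \<cdot>\<^bsub>D\<^esub> assoc D (psf_mor G v) (psf_mor G u) f"
proof -
  let ?i = "rpa_i F X" and ?\<eta> = "rpa_unit F X A f" and ?s = "sharp X A f"
  let ?Gv = "psf_mor G v" and ?Gu = "psf_mor G u" and ?Gs = "psf_mor G (sharp X A f)"
  let ?\<gamma>vu = "psf_comp G v u" and ?\<gamma>us = "psf_comp G u ?s"
    and ?\<gamma>v = "psf_comp G v (u \<odot>\<^bsub>E\<^esub> ?s)" and ?\<gamma>s = "psf_comp G (v \<odot>\<^bsub>E\<^esub> u) ?s"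
  let ?a = "assoc D"
  let ?E = "(?Gv \<odot>\<^bsub>D\<^esub> ?Gu) \<rhd>\<^bsub>D\<^esub> ?\<eta>" and ?b = "inv2 D (?a (?Gv \<odot>\<^bsub>D\<^esub> ?Gu) ?Gs ?i)"
  note [simp] = assms
  have l1: "(psf_mor G (v \<odot>\<^bsub>E\<^esub> u) \<rhd>\<^bsub>D\<^esub> ?\<eta>) \<cdot>\<^bsub>D\<^esub> (?\<gamma>vu \<lhd>\<^bsub>D\<^esub> f)
      = (?\<gamma>vu \<lhd>\<^bsub>D\<^esub> (?Gs \<odot>\<^bsub>D\<^esub> ?i)) \<cdot>\<^bsub>D\<^esub> ?E"
    by (simp add: J.D.hcomp_vcomp)
  have l2: "inv2 D (?a (psf_mor G (v \<odot>\<^bsub>E\<^esub> u)) ?Gs ?i) \<cdot>\<^bsub>D\<^esub> (?\<gamma>vu \<lhd>\<^bsub>D\<^esub> (?Gs \<odot>\<^bsub>D\<^esub> ?i))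
      = ((?\<gamma>vu \<lhd>\<^bsub>D\<^esub> ?Gs) \<lhd>\<^bsub>D\<^esub> ?i) \<cdot>\<^bsub>D\<^esub> ?b"
    using J.D.inv_assoc_nat[of ?\<gamma>vu "id2 D ?Gs" "id2 D ?i"] by simp
  have "kcell X (v \<odot>\<^bsub>E\<^esub> u) f \<cdot>\<^bsub>D\<^esub> (?\<gamma>vu \<lhd>\<^bsub>D\<^esub> f)
      = (?\<gamma>s \<lhd>\<^bsub>D\<^esub> ?i) \<cdot>\<^bsub>D\<^esub> ((?\<gamma>vu \<lhd>\<^bsub>D\<^esub> ?Gs) \<lhd>\<^bsub>D\<^esub> ?i) \<cdot>\<^bsub>D\<^esub> ?b \<cdot>\<^bsub>D\<^esub> ?E"
    unfolding kcell_def using l1 J.D.vcomp_eq_extend[OF l2, of ?E] by simp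
  \<comment> \<open>Interchange and naturality of the inverse associator have moved the compositor
    of \<open>v\<close> and \<open>u\<close> to the left, so that one side of the axiom of
    \<open>G\<close> stands under a single whiskering by \<open>?i\<close>.\<close>
  then have L: "(psf_cell G (assoc E v u ?s) \<lhd>\<^bsub>D\<^esub> ?i) \<cdot>\<^bsub>D\<^esub> kcell X (v \<odot>\<^bsub>E\<^esub> u) f \<cdot>\<^bsub>D\<^esub> (?\<gamma>vu \<lhd>\<^bsub>D\<^esub> f)
      = ((psf_cell G (assoc E v u ?s) \<cdot>\<^bsub>D\<^esub> ?\<gamma>s \<cdot>\<^bsub>D\<^esub> (?\<gamma>vu \<lhd>\<^bsub>D\<^esub> ?Gs)) \<lhd>\<^bsub>D\<^esub> ?i) \<cdot>\<^bsub>D\<^esub> ?b \<cdot>\<^bsub>D\<^esub> ?E"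
    by (simp flip: J.D.rwhisker_vcomp)
  have r1: "(?Gv \<rhd>\<^bsub>D\<^esub> (?Gu \<rhd>\<^bsub>D\<^esub> ?\<eta>)) \<cdot>\<^bsub>D\<^esub> ?a ?Gv ?Gu f = ?a ?Gv ?Gu (?Gs \<odot>\<^bsub>D\<^esub> ?i) \<cdot>\<^bsub>D\<^esub> ?E"
    using J.D.assoc_nat[of "id2 D ?Gv" "id2 D ?Gu" ?\<eta>] by simp
  have r2: "inv2 D (?a ?Gv (psf_mor G (u \<odot>\<^bsub>E\<^esub> ?s)) ?i) \<cdot>\<^bsub>D\<^esub> (?Gv \<rhd>\<^bsub>D\<^esub> (?\<gamma>us \<lhd>\<^bsub>D\<^esub> ?i))
      = ((?Gv \<rhd>\<^bsub>D\<^esub> ?\<gamma>us) \<lhd>\<^bsub>D\<^esub> ?i) \<cdot>\<^bsub>D\<^esub> inv2 D (?a ?Gv (?Gu \<odot>\<^bsub>D\<^esub> ?Gs) ?i)"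
    by (rule J.D.inv_assoc_nat) simp_all
  \<comment> \<open>The pentagon of \<open>D\<close> turns the three associators that arise from the
    two nested uses of \<open>kcell\<close> into the associator of the axiom of \<open>G\<close> and
    \<open>?b\<close>.\<close>
  have r3: "inv2 D (?a ?Gv (?Gu \<odot>\<^bsub>D\<^esub> ?Gs) ?i) \<cdot>\<^bsub>D\<^esub> (?Gv \<rhd>\<^bsub>D\<^esub> inv2 D (?a ?Gu ?Gs ?i))
        \<cdot>\<^bsub>D\<^esub> ?a ?Gv ?Gu (?Gs \<odot>\<^bsub>D\<^esub> ?i) \<cdot>\<^bsub>D\<^esub> ?E = (?a ?Gv ?Gu ?Gs \<lhd>\<^bsub>D\<^esub> ?i) \<cdot>\<^bsub>D\<^esub> ?b \<cdot>\<^bsub>D\<^esub> ?E"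
    using arg_cong[OF J.D.inv_pentagon[of ?Gv ?Gu ?Gs ?i], of "\<lambda>x. x \<cdot>\<^bsub>D\<^esub> ?E"] by simp
  have "(psf_cell G (v \<rhd>\<^bsub>E\<^esub> kappa X u f) \<lhd>\<^bsub>D\<^esub> ?i) \<cdot>\<^bsub>D\<^esub> kcell X v (?Gu \<odot>\<^bsub>D\<^esub> f)
      = (?\<gamma>v \<lhd>\<^bsub>D\<^esub> ?i) \<cdot>\<^bsub>D\<^esub> inv2 D (?a ?Gv (psf_mor G (u \<odot>\<^bsub>E\<^esub> ?s)) ?i) \<cdot>\<^bsub>D\<^esub> (?Gv \<rhd>\<^bsub>D\<^esub> kcell X u f)"
    \<comment> \<open>Here \<open>\<tau>\<close> is \<open>kcell X u f\<close>, the transpose of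
      \<open>kappa X u f\<close>.\<close>
    by (rule kcell_lwhisker[OF _ _ _ _ _ _ _ _ _ kappa_unit]) simp_all
  also have "?Gv \<rhd>\<^bsub>D\<^esub> kcell X u f = (?Gv \<rhd>\<^bsub>D\<^esub> (?\<gamma>us \<lhd>\<^bsub>D\<^esub> ?i)) \<cdot>\<^bsub>D\<^esub> (?Gv \<rhd>\<^bsub>D\<^esub> inv2 D (?a ?Gu ?Gs ?i))
      \<cdot>\<^bsub>D\<^esub> (?Gv \<rhd>\<^bsub>D\<^esub> (?Gu \<rhd>\<^bsub>D\<^esub> ?\<eta>))"
    unfolding kcell_def by (simp add: J.D.lwhisker_vcomp)
  finally have eq: "(psf_cell G (v \<rhd>\<^bsub>E\<^esub> kappa X u f) \<lhd>\<^bsub>D\<^esub> ?i) \<cdot>\<^bsub>D\<^esub> kcell X v (?Gu \<odot>\<^bsub>D\<^esub> f)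
     = (?\<gamma>v \<lhd>\<^bsub>D\<^esub> ?i) \<cdot>\<^bsub>D\<^esub> inv2 D (?a ?Gv (psf_mor G (u \<odot>\<^bsub>E\<^esub> ?s)) ?i) \<cdot>\<^bsub>D\<^esub> (?Gv \<rhd>\<^bsub>D\<^esub> (?\<gamma>us \<lhd>\<^bsub>D\<^esub> ?i))
      \<cdot>\<^bsub>D\<^esub> (?Gv \<rhd>\<^bsub>D\<^esub> inv2 D (?a ?Gu ?Gs ?i)) \<cdot>\<^bsub>D\<^esub> (?Gv \<rhd>\<^bsub>D\<^esub> (?Gu \<rhd>\<^bsub>D\<^esub> ?\<eta>))" .
  have "(psf_cell G (v \<rhd>\<^bsub>E\<^esub> kappa X u f) \<lhd>\<^bsub>D\<^esub> ?i) \<cdot>\<^bsub>D\<^esub> kcell X v (?Gu \<odot>\<^bsub>D\<^esub> f) \<cdot>\<^bsub>D\<^esub> ?a ?Gv ?Gu f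
     = (?\<gamma>v \<lhd>\<^bsub>D\<^esub> ?i) \<cdot>\<^bsub>D\<^esub> inv2 D (?a ?Gv (psf_mor G (u \<odot>\<^bsub>E\<^esub> ?s)) ?i) \<cdot>\<^bsub>D\<^esub> (?Gv \<rhd>\<^bsub>D\<^esub> (?\<gamma>us \<lhd>\<^bsub>D\<^esub> ?i))
      \<cdot>\<^bsub>D\<^esub> (?Gv \<rhd>\<^bsub>D\<^esub> inv2 D (?a ?Gu ?Gs ?i)) \<cdot>\<^bsub>D\<^esub> (?Gv \<rhd>\<^bsub>D\<^esub> (?Gu \<rhd>\<^bsub>D\<^esub> ?\<eta>)) \<cdot>\<^bsub>D\<^esub> ?a ?Gv ?Gu f"
    by (subst J.D.vcomp_eq_extend1[OF eq]) simp_all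
  also have "\<dots> = (?\<gamma>v \<lhd>\<^bsub>D\<^esub> ?i) \<cdot>\<^bsub>D\<^esub> ((?Gv \<rhd>\<^bsub>D\<^esub> ?\<gamma>us) \<lhd>\<^bsub>D\<^esub> ?i) \<cdot>\<^bsub>D\<^esub> (?a ?Gv ?Gu ?Gs \<lhd>\<^bsub>D\<^esub> ?i) \<cdot>\<^bsub>D\<^esub> ?b \<cdot>\<^bsub>D\<^esub> ?E"
    unfolding r1
    by (subst J.D.vcomp_eq_extend[OF r2], simp_all only: r3) simp_all
  also have "\<dots> = ((?\<gamma>v \<cdot>\<^bsub>D\<^esub> (?Gv \<rhd>\<^bsub>D\<^esub> ?\<gamma>us) \<cdot>\<^bsub>D\<^esub> ?a ?Gv ?Gu ?Gs) \<lhd>\<^bsub>D\<^esub> ?i) \<cdot>\<^bsub>D\<^esub> ?b \<cdot>\<^bsub>D\<^esub> ?E"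
    by (simp flip: J.D.rwhisker_vcomp)
  also have "?\<gamma>v \<cdot>\<^bsub>D\<^esub> (?Gv \<rhd>\<^bsub>D\<^esub> ?\<gamma>us) \<cdot>\<^bsub>D\<^esub> ?a ?Gv ?Gu ?Gs
      = psf_cell G (assoc E v u ?s) \<cdot>\<^bsub>D\<^esub> ?\<gamma>s \<cdot>\<^bsub>D\<^esub> (?\<gamma>vu \<lhd>\<^bsub>D\<^esub> ?Gs)"
    by (rule G.assoc_P[symmetric]) simp_all
  finally show ?thesis
    using L by simp
qed

lemma kappa_assoc:
  assumes "X \<in> Obj C" "v \<in> Mor E" "u \<in> Mor E" "src E v = trg E u"
    "f \<in> Mor D" "src D f = psf_obj J X" "trg D f = psf_obj G A" "A = src E u" "B = trg E v"
  shows "assoc E v u (sharp X A f) \<cdot>\<^bsub>E\<^esub> kappa X (v \<odot>\<^bsub>E\<^esub> u) f \<cdot>\<^bsub>E\<^esub> sharp2 X B (psf_comp G v u \<lhd>\<^bsub>D\<^esub> f)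
    = (v \<rhd>\<^bsub>E\<^esub> kappa X u f) \<cdot>\<^bsub>E\<^esub> kappa X v (psf_mor G u \<odot>\<^bsub>D\<^esub> f)
      \<cdot>\<^bsub>E\<^esub> sharp2 X B (assoc D (psf_mor G v) (psf_mor G u) f)"
    (is "?l = ?r")
proof (rule cell_from_sharp_eqI)
  let ?h = "(psf_mor G v \<odot>\<^bsub>D\<^esub> psf_mor G u) \<odot>\<^bsub>D\<^esub> f"
  show "(psf_cell G ?l \<lhd>\<^bsub>D\<^esub> rpa_i F X) \<cdot>\<^bsub>D\<^esub> rpa_unit F X B ?h
      = (psf_cell G ?r \<lhd>\<^bsub>D\<^esub> rpa_i F X) \<cdot>\<^bsub>D\<^esub> rpa_unit F X B ?h"
    using assms kcell_comp[of X v u f A]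
    by (subst transpose_kappa_sharp2, simp_all)+
qed (use assms in simp_all)

section \<open>The unit comparison \<open>theta_cell\<close>\<close>

definition theta_cell :: "'oc \<Rightarrow> 'ce" where
  "theta_cell X = transp X (id1 E (rpa_obj F X))
     ((psf_id G (rpa_obj F X) \<lhd>\<^bsub>D\<^esub> rpa_i F X) \<cdot>\<^bsub>D\<^esub> inv2 D (lunit D (rpa_i F X)))"

lemma theta_cell_simps [simp]:
  assumes "X \<in> Obj C"
  shows "theta_cell X \<in> Cell E" "src2 E (theta_cell X) = sharp X (rpa_obj F X) (rpa_i F X)"
    "trg2 E (theta_cell X) = id1 E (rpa_obj F X)" "invertible E (theta_cell X)"
  using assms by (simp_all add: theta_cell_def)

lemma theta_cell_unit:
  assumes "X \<in> Obj C"
  shows "(psf_cell G (theta_cell X) \<lhd>\<^bsub>D\<^esub> rpa_i F X) \<cdot>\<^bsub>D\<^esub> rpa_unit F X (rpa_obj F X) (rpa_i F X)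
    = (psf_id G (rpa_obj F X) \<lhd>\<^bsub>D\<^esub> rpa_i F X) \<cdot>\<^bsub>D\<^esub> inv2 D (lunit D (rpa_i F X))"
  unfolding theta_cell_def using assms by (intro transp_unit) simp_all

text \<open>The unit axiom of the pseudomonad before \<open>G\<close> is applied. After
  transposition it reduces to the right unit axiom of \<open>G\<close> and the triangle of
  \<open>D\<close>.\<close>

lemma kappa_theta_cell:
  assumes "X \<in> Obj C" "A \<in> Obj E" "f \<in> Mor D" "src D f = psf_obj J X" "trg D f = psf_obj G A"
  shows "runit E (sharp X A f) \<cdot>\<^bsub>E\<^esub> (sharp X A f \<rhd>\<^bsub>E\<^esub> theta_cell X)
      \<cdot>\<^bsub>E\<^esub> kappa X (sharp X A f) (rpa_i F X) \<cdot>\<^bsub>E\<^esub> sharp2 X A (rpa_unit F X A f)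
    = id2 E (sharp X A f)" (is "?l = _")
proof (rule cell_from_sharp_eqI)
  let ?i = "rpa_i F X" and ?s = "sharp X A f" and ?o = "rpa_obj F X" and ?\<eta> = "rpa_unit F X A f"
  let ?\<psi> = "runit E ?s \<cdot>\<^bsub>E\<^esub> (?s \<rhd>\<^bsub>E\<^esub> theta_cell X)"
  let ?Gs = "psf_mor G ?s" and ?\<iota> = "psf_id G ?o" and ?l = "inv2 D (lunit D ?i)"
    and ?\<gamma> = "psf_comp G ?s (id1 E ?o)"
  let ?b = "inv2 D (assoc D ?Gs (id1 D (psf_obj G ?o)) ?i)"
  note [simp] = assms
  have "(psf_cell G ?\<psi> \<lhd>\<^bsub>D\<^esub> ?i) \<cdot>\<^bsub>D\<^esub> kcell X ?s ?i
     = (psf_cell G (runit E ?s) \<lhd>\<^bsub>D\<^esub> ?i) \<cdot>\<^bsub>D\<^esub> (psf_cell G (?s \<rhd>\<^bsub>E\<^esub> theta_cell X) \<lhd>\<^bsub>D\<^esub> ?i) \<cdot>\<^bsub>D\<^esub> kcell X ?s ?i"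
    by (simp flip: G_rwhisker_vcomp)
  also have "(psf_cell G (?s \<rhd>\<^bsub>E\<^esub> theta_cell X) \<lhd>\<^bsub>D\<^esub> ?i) \<cdot>\<^bsub>D\<^esub> kcell X ?s ?i = (?\<gamma> \<lhd>\<^bsub>D\<^esub> ?i)
      \<cdot>\<^bsub>D\<^esub> inv2 D (assoc D ?Gs (psf_mor G (id1 E ?o)) ?i) \<cdot>\<^bsub>D\<^esub> (?Gs \<rhd>\<^bsub>D\<^esub> ((?\<iota> \<lhd>\<^bsub>D\<^esub> ?i) \<cdot>\<^bsub>D\<^esub> ?l))"
    by (rule kcell_lwhisker[OF _ _ _ _ _ _ _ _ _ theta_cell_unit]) simp_all
  also have "?Gs \<rhd>\<^bsub>D\<^esub> ((?\<iota> \<lhd>\<^bsub>D\<^esub> ?i) \<cdot>\<^bsub>D\<^esub> ?l) = (?Gs \<rhd>\<^bsub>D\<^esub> (?\<iota> \<lhd>\<^bsub>D\<^esub> ?i)) \<cdot>\<^bsub>D\<^esub> (?Gs \<rhd>\<^bsub>D\<^esub> ?l)"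
    by (rule J.D.lwhisker_vcomp[symmetric]) simp_all
  \<comment> \<open>Naturality of the inverse associator brings the unitor next to the compositor,
    as the right unit axiom of \<open>G\<close> requires.\<close>
  also have "inv2 D (assoc D ?Gs (psf_mor G (id1 E ?o)) ?i) \<cdot>\<^bsub>D\<^esub> (?Gs \<rhd>\<^bsub>D\<^esub> (?\<iota> \<lhd>\<^bsub>D\<^esub> ?i)) \<cdot>\<^bsub>D\<^esub> (?Gs \<rhd>\<^bsub>D\<^esub> ?l)
      = ((?Gs \<rhd>\<^bsub>D\<^esub> ?\<iota>) \<lhd>\<^bsub>D\<^esub> ?i) \<cdot>\<^bsub>D\<^esub> ?b \<cdot>\<^bsub>D\<^esub> (?Gs \<rhd>\<^bsub>D\<^esub> ?l)"
    by (intro J.D.vcomp_eq_extend J.D.inv_assoc_nat) simp_all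
  also have "(psf_cell G (runit E ?s) \<lhd>\<^bsub>D\<^esub> ?i) \<cdot>\<^bsub>D\<^esub> (?\<gamma> \<lhd>\<^bsub>D\<^esub> ?i) \<cdot>\<^bsub>D\<^esub> \<dots>
      = ((psf_cell G (runit E ?s) \<cdot>\<^bsub>D\<^esub> ?\<gamma> \<cdot>\<^bsub>D\<^esub> (?Gs \<rhd>\<^bsub>D\<^esub> ?\<iota>)) \<lhd>\<^bsub>D\<^esub> ?i) \<cdot>\<^bsub>D\<^esub> ?b \<cdot>\<^bsub>D\<^esub> (?Gs \<rhd>\<^bsub>D\<^esub> ?l)"
    by (simp flip: J.D.rwhisker_vcomp)
  also have "\<dots> = id2 D (?Gs \<odot>\<^bsub>D\<^esub> ?i)"
    by (simp add: G.runit_P J.D.inv_triangle)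
  finally have *: "(psf_cell G ?\<psi> \<lhd>\<^bsub>D\<^esub> ?i) \<cdot>\<^bsub>D\<^esub> kcell X ?s ?i = id2 D (?Gs \<odot>\<^bsub>D\<^esub> ?i)" .
  have "(psf_cell G (?\<psi> \<cdot>\<^bsub>E\<^esub> kappa X ?s ?i \<cdot>\<^bsub>E\<^esub> sharp2 X A ?\<eta>) \<lhd>\<^bsub>D\<^esub> ?i) \<cdot>\<^bsub>D\<^esub> ?\<eta>
     = (psf_cell G ?\<psi> \<lhd>\<^bsub>D\<^esub> ?i) \<cdot>\<^bsub>D\<^esub> kcell X ?s ?i \<cdot>\<^bsub>D\<^esub> ?\<eta>"
    by (rule transpose_kappa_sharp2) simp_all
  also have "\<dots> = ?\<eta>"
    by (subst J.D.vcomp_eq_extend1[OF *]) simp_all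
  finally show "(psf_cell G (runit E ?s \<cdot>\<^bsub>E\<^esub> (?s \<rhd>\<^bsub>E\<^esub> theta_cell X) \<cdot>\<^bsub>E\<^esub> kappa X ?s ?i \<cdot>\<^bsub>E\<^esub> sharp2 X A ?\<eta>)
        \<lhd>\<^bsub>D\<^esub> ?i) \<cdot>\<^bsub>D\<^esub> ?\<eta> = (psf_cell G (id2 E ?s) \<lhd>\<^bsub>D\<^esub> ?i) \<cdot>\<^bsub>D\<^esub> ?\<eta>"
    by simp
qed (use assms in simp_all)

section \<open>The induced relative pseudomonad\<close>

definition mu_cell :: "'oc \<Rightarrow> 'me \<Rightarrow> 'md \<Rightarrow> 'cd" where
  "mu_cell X u f = inv2 D (psf_comp G u (sharp X (src E u) f)) \<cdot>\<^bsub>D\<^esub> psf_cell G (kappa X u f)"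

lemma mu_cell_simps [simp]:
  assumes "X \<in> Obj C" "u \<in> Mor E" "f \<in> Mor D" "src D f = psf_obj J X" "trg D f = psf_obj G (src E u)"
  shows "mu_cell X u f \<in> Cell D"
    "src2 D (mu_cell X u f) = psf_mor G (sharp X (trg E u) (psf_mor G u \<odot>\<^bsub>D\<^esub> f))"
    "trg2 D (mu_cell X u f) = psf_mor G u \<odot>\<^bsub>D\<^esub> psf_mor G (sharp X (src E u) f)"
    "invertible D (mu_cell X u f)"
  using assms by (simp_all add: mu_cell_def)

text \<open>Naturality of the inverse compositor combined with the image under \<open>G\<close> of
  \<open>kappa_nat\<close>.\<close>

lemma mu_cell_nat:
  assumes "X \<in> Obj C" "\<alpha> \<in> Cell E" "\<beta> \<in> Cell D"
    "src D (src2 D \<beta>) = psf_obj J X" "trg D (src2 D \<beta>) = psf_obj G (src E (src2 E \<alpha>))"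
    "u = src2 E \<alpha>" "f = src2 D \<beta>" "u' = trg2 E \<alpha>" "f' = trg2 D \<beta>" "A = src E u" "B = trg E u"
  shows "(psf_cell G \<alpha> \<star>\<^bsub>D\<^esub> psf_cell G (sharp2 X A \<beta>)) \<cdot>\<^bsub>D\<^esub> mu_cell X u f
    = mu_cell X u' f' \<cdot>\<^bsub>D\<^esub> psf_cell G (sharp2 X B (psf_cell G \<alpha> \<star>\<^bsub>D\<^esub> \<beta>))"
proof -
  let ?\<gamma> = "psf_comp G u (sharp X A f)" and ?\<gamma>' = "psf_comp G u' (sharp X A f')"
  have 1: "(psf_cell G \<alpha> \<star>\<^bsub>D\<^esub> psf_cell G (sharp2 X A \<beta>)) \<cdot>\<^bsub>D\<^esub> inv2 D ?\<gamma>
      = inv2 D ?\<gamma>' \<cdot>\<^bsub>D\<^esub> psf_cell G (\<alpha> \<star>\<^bsub>E\<^esub> sharp2 X A \<beta>)"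
    using assms by (intro G.inv_comp_P_nat[symmetric]) simp_all
  have "(psf_cell G \<alpha> \<star>\<^bsub>D\<^esub> psf_cell G (sharp2 X A \<beta>)) \<cdot>\<^bsub>D\<^esub> mu_cell X u f
      = inv2 D ?\<gamma>' \<cdot>\<^bsub>D\<^esub> psf_cell G ((\<alpha> \<star>\<^bsub>E\<^esub> sharp2 X A \<beta>) \<cdot>\<^bsub>E\<^esub> kappa X u f)"
    unfolding mu_cell_def using assms J.D.vcomp_eq_extend[OF 1, of "psf_cell G (kappa X u f)"]
    by (simp add: G.vcomp_P)
  also have "\<dots> = mu_cell X u' f' \<cdot>\<^bsub>D\<^esub> psf_cell G (sharp2 X B (psf_cell G \<alpha> \<star>\<^bsub>D\<^esub> \<beta>))"
    unfolding mu_cell_def kappa_nat[OF assms] using assms by (simp flip: G.vcomp_P)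
  finally show ?thesis .
qed

lemma inv_comp_G_lwhisker:
  assumes "v \<in> Mor E" "\<phi> \<in> Cell E" "src E v = trg E (src2 E \<phi>)" "s = src2 E \<phi>" "t = trg2 E \<phi>"
  shows "(psf_mor G v \<rhd>\<^bsub>D\<^esub> psf_cell G \<phi>) \<cdot>\<^bsub>D\<^esub> inv2 D (psf_comp G v s)
    = inv2 D (psf_comp G v t) \<cdot>\<^bsub>D\<^esub> psf_cell G (v \<rhd>\<^bsub>E\<^esub> \<phi>)"
  using G.inv_comp_P_nat[of "id2 E v" \<phi> v s v t] assms by simp

text \<open>Associativity for arbitrary \<open>v\<close>; the axiom is the case where
  \<open>v\<close> is a value of \<open>sharp\<close>. The part inside \<open>E\<close> follows from
  \<open>kappa_assoc\<close> and naturality of \<open>kappa\<close>; the compositors of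
  \<open>G\<close> left over are handled by \<open>inv_assoc_P\<close>.\<close>

lemma mu_cell_assoc:
  assumes "X \<in> Obj C" "Y \<in> Obj C" "v \<in> Mor E" "B = src E v" "V = trg E v"
    "g \<in> Mor D" "src D g = psf_obj J Y" "trg D g = psf_obj G B"
    "f \<in> Mor D" "src D f = psf_obj J X" "trg D f = psf_obj G (rpa_obj F Y)"
  shows "(psf_mor G v \<rhd>\<^bsub>D\<^esub> mu_cell X (sharp Y B g) f)
      \<cdot>\<^bsub>D\<^esub> mu_cell X v (psf_mor G (sharp Y B g) \<odot>\<^bsub>D\<^esub> f)
      \<cdot>\<^bsub>D\<^esub> psf_cell G (sharp2 X V (assoc D (psf_mor G v) (psf_mor G (sharp Y B g)) f))
      \<cdot>\<^bsub>D\<^esub> psf_cell G (sharp2 X V (mu_cell Y v g \<lhd>\<^bsub>D\<^esub> f))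
    = assoc D (psf_mor G v) (psf_mor G (sharp Y B g)) (psf_mor G (sharp X (rpa_obj F Y) f))
      \<cdot>\<^bsub>D\<^esub> (mu_cell Y v g \<lhd>\<^bsub>D\<^esub> psf_mor G (sharp X (rpa_obj F Y) f))
      \<cdot>\<^bsub>D\<^esub> mu_cell X (sharp Y V (psf_mor G v \<odot>\<^bsub>D\<^esub> g)) f"
proof -
  let ?u = "sharp Y B g" and ?s = "sharp X (rpa_obj F Y) f" and ?p = "sharp Y V (psf_mor G v \<odot>\<^bsub>D\<^esub> g)"
  let ?Gv = "psf_mor G v" and ?Gu = "psf_mor G ?u" and ?Gs = "psf_mor G ?s"
  let ?t = "sharp X B (?Gu \<odot>\<^bsub>D\<^esub> f)"
  let ?a = "sharp2 X V (assoc D ?Gv ?Gu f)" and ?m = "sharp2 X V (mu_cell Y v g \<lhd>\<^bsub>D\<^esub> f)"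
    and ?K = "sharp2 X V (psf_cell G (kappa Y v g) \<lhd>\<^bsub>D\<^esub> f)"
  let ?\<gamma>us = "inv2 D (psf_comp G ?u ?s)" and ?\<gamma>vt = "inv2 D (psf_comp G v ?t)"
    and ?\<gamma>v = "inv2 D (psf_comp G v (?u \<odot>\<^bsub>E\<^esub> ?s))" and ?\<gamma>s = "inv2 D (psf_comp G (v \<odot>\<^bsub>E\<^esub> ?u) ?s)"
    and ?\<gamma>vu = "inv2 D (psf_comp G v ?u)" and ?\<gamma>p = "inv2 D (psf_comp G ?p ?s)"
  note [simp] = assms
  \<comment> \<open>Splitting off the inverse compositor lets it cancel, by the next fact, the
    compositor produced by \<open>kappa_assoc\<close>.\<close>
  have m: "?m = sharp2 X V (?\<gamma>vu \<lhd>\<^bsub>D\<^esub> f) \<cdot>\<^bsub>E\<^esub> ?K"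
    unfolding mu_cell_def by (simp add: sharp2_vcomp J.D.rwhisker_vcomp)
  have \<gamma>\<gamma>: "sharp2 X V (psf_comp G v ?u \<lhd>\<^bsub>D\<^esub> f) \<cdot>\<^bsub>E\<^esub> sharp2 X V (?\<gamma>vu \<lhd>\<^bsub>D\<^esub> f)
      = id2 E (sharp X V (psf_mor G (v \<odot>\<^bsub>E\<^esub> ?u) \<odot>\<^bsub>D\<^esub> f))"
    by (simp add: sharp2_vcomp J.D.rwhisker_vcomp)
  have "(v \<rhd>\<^bsub>E\<^esub> kappa X ?u f) \<cdot>\<^bsub>E\<^esub> kappa X v (?Gu \<odot>\<^bsub>D\<^esub> f) \<cdot>\<^bsub>E\<^esub> ?a \<cdot>\<^bsub>E\<^esub> ?m
      = ((v \<rhd>\<^bsub>E\<^esub> kappa X ?u f) \<cdot>\<^bsub>E\<^esub> kappa X v (?Gu \<odot>\<^bsub>D\<^esub> f) \<cdot>\<^bsub>E\<^esub> ?a) \<cdot>\<^bsub>E\<^esub> ?m"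
    by simp
  also have "\<dots> = (assoc E v ?u ?s \<cdot>\<^bsub>E\<^esub> kappa X (v \<odot>\<^bsub>E\<^esub> ?u) f
      \<cdot>\<^bsub>E\<^esub> sharp2 X V (psf_comp G v ?u \<lhd>\<^bsub>D\<^esub> f)) \<cdot>\<^bsub>E\<^esub> sharp2 X V (?\<gamma>vu \<lhd>\<^bsub>D\<^esub> f) \<cdot>\<^bsub>E\<^esub> ?K"
    by (subst kappa_assoc) (simp_all only: m, simp_all)
  also have "\<dots> = assoc E v ?u ?s \<cdot>\<^bsub>E\<^esub> kappa X (v \<odot>\<^bsub>E\<^esub> ?u) f
      \<cdot>\<^bsub>E\<^esub> sharp2 X V (psf_comp G v ?u \<lhd>\<^bsub>D\<^esub> f) \<cdot>\<^bsub>E\<^esub> sharp2 X V (?\<gamma>vu \<lhd>\<^bsub>D\<^esub> f) \<cdot>\<^bsub>E\<^esub> ?K"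
    by simp
  also have "\<dots> = assoc E v ?u ?s \<cdot>\<^bsub>E\<^esub> kappa X (v \<odot>\<^bsub>E\<^esub> ?u) f \<cdot>\<^bsub>E\<^esub> ?K"
    by (subst G.C.vcomp_eq_extend1[OF \<gamma>\<gamma>]) simp_all
  also have "kappa X (v \<odot>\<^bsub>E\<^esub> ?u) f \<cdot>\<^bsub>E\<^esub> ?K = (kappa Y v g \<lhd>\<^bsub>E\<^esub> ?s) \<cdot>\<^bsub>E\<^esub> kappa X ?p f"
    \<comment> \<open>Naturality in the first argument, applied to the 2-cell
      \<open>kappa Y v g\<close> itself.\<close>
    using kappa_nat[of X "kappa Y v g" "id2 D f"] by simp
  finally have E: "(v \<rhd>\<^bsub>E\<^esub> kappa X ?u f) \<cdot>\<^bsub>E\<^esub> kappa X v (?Gu \<odot>\<^bsub>D\<^esub> f) \<cdot>\<^bsub>E\<^esub> ?a \<cdot>\<^bsub>E\<^esub> ?m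
      = assoc E v ?u ?s \<cdot>\<^bsub>E\<^esub> (kappa Y v g \<lhd>\<^bsub>E\<^esub> ?s) \<cdot>\<^bsub>E\<^esub> kappa X ?p f" .
  let ?R = "psf_cell G (kappa X v (?Gu \<odot>\<^bsub>D\<^esub> f)) \<cdot>\<^bsub>D\<^esub> psf_cell G ?a \<cdot>\<^bsub>D\<^esub> psf_cell G ?m"
  \<comment> \<open>The compositor between the two multiplications is moved left, so that the
    remaining factors are all images under \<open>G\<close> and equation \<open>E\<close>
    applies.\<close>
  have l: "(?Gv \<rhd>\<^bsub>D\<^esub> psf_cell G (kappa X ?u f)) \<cdot>\<^bsub>D\<^esub> ?\<gamma>vt = ?\<gamma>v \<cdot>\<^bsub>D\<^esub> psf_cell G (v \<rhd>\<^bsub>E\<^esub> kappa X ?u f)"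
    by (rule inv_comp_G_lwhisker) simp_all
  have "(?Gv \<rhd>\<^bsub>D\<^esub> mu_cell X ?u f) \<cdot>\<^bsub>D\<^esub> mu_cell X v (?Gu \<odot>\<^bsub>D\<^esub> f) \<cdot>\<^bsub>D\<^esub> psf_cell G ?a \<cdot>\<^bsub>D\<^esub> psf_cell G ?m
      = (?Gv \<rhd>\<^bsub>D\<^esub> ?\<gamma>us) \<cdot>\<^bsub>D\<^esub> (?Gv \<rhd>\<^bsub>D\<^esub> psf_cell G (kappa X ?u f)) \<cdot>\<^bsub>D\<^esub> ?\<gamma>vt \<cdot>\<^bsub>D\<^esub> ?R"
    unfolding mu_cell_def[of X] by (simp flip: J.D.lwhisker_vcomp)
  also have "\<dots> = (?Gv \<rhd>\<^bsub>D\<^esub> ?\<gamma>us) \<cdot>\<^bsub>D\<^esub> ?\<gamma>v \<cdot>\<^bsub>D\<^esub> psf_cell G (v \<rhd>\<^bsub>E\<^esub> kappa X ?u f) \<cdot>\<^bsub>D\<^esub> ?R"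
    by (subst J.D.vcomp_eq_extend[OF l]) simp_all
  also have "psf_cell G (v \<rhd>\<^bsub>E\<^esub> kappa X ?u f) \<cdot>\<^bsub>D\<^esub> ?R
      = psf_cell G (assoc E v ?u ?s \<cdot>\<^bsub>E\<^esub> (kappa Y v g \<lhd>\<^bsub>E\<^esub> ?s) \<cdot>\<^bsub>E\<^esub> kappa X ?p f)"
    unfolding E[symmetric] by (simp flip: G.vcomp_P)
  also have "(?Gv \<rhd>\<^bsub>D\<^esub> ?\<gamma>us) \<cdot>\<^bsub>D\<^esub> ?\<gamma>v \<cdot>\<^bsub>D\<^esub> \<dots>
      = ((?Gv \<rhd>\<^bsub>D\<^esub> ?\<gamma>us) \<cdot>\<^bsub>D\<^esub> ?\<gamma>v \<cdot>\<^bsub>D\<^esub> psf_cell G (assoc E v ?u ?s))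
        \<cdot>\<^bsub>D\<^esub> psf_cell G (kappa Y v g \<lhd>\<^bsub>E\<^esub> ?s) \<cdot>\<^bsub>D\<^esub> psf_cell G (kappa X ?p f)"
    by (simp flip: G.vcomp_P)
  also have "(?Gv \<rhd>\<^bsub>D\<^esub> ?\<gamma>us) \<cdot>\<^bsub>D\<^esub> ?\<gamma>v \<cdot>\<^bsub>D\<^esub> psf_cell G (assoc E v ?u ?s)
      = assoc D ?Gv ?Gu ?Gs \<cdot>\<^bsub>D\<^esub> (?\<gamma>vu \<lhd>\<^bsub>D\<^esub> ?Gs) \<cdot>\<^bsub>D\<^esub> ?\<gamma>s"
    by (rule G.inv_assoc_P) simp_all
  finally have L: "(?Gv \<rhd>\<^bsub>D\<^esub> mu_cell X ?u f) \<cdot>\<^bsub>D\<^esub> mu_cell X v (?Gu \<odot>\<^bsub>D\<^esub> f) \<cdot>\<^bsub>D\<^esub> psf_cell G ?a \<cdot>\<^bsub>D\<^esub> psf_cell G ?m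
      = (assoc D ?Gv ?Gu ?Gs \<cdot>\<^bsub>D\<^esub> (?\<gamma>vu \<lhd>\<^bsub>D\<^esub> ?Gs) \<cdot>\<^bsub>D\<^esub> ?\<gamma>s)
        \<cdot>\<^bsub>D\<^esub> psf_cell G (kappa Y v g \<lhd>\<^bsub>E\<^esub> ?s) \<cdot>\<^bsub>D\<^esub> psf_cell G (kappa X ?p f)" .
  have r: "(psf_cell G (kappa Y v g) \<lhd>\<^bsub>D\<^esub> ?Gs) \<cdot>\<^bsub>D\<^esub> ?\<gamma>p = ?\<gamma>s \<cdot>\<^bsub>D\<^esub> psf_cell G (kappa Y v g \<lhd>\<^bsub>E\<^esub> ?s)"
    using G.inv_comp_P_nat[of "kappa Y v g" "id2 E ?s"] by simp
  have "(mu_cell Y v g \<lhd>\<^bsub>D\<^esub> ?Gs) \<cdot>\<^bsub>D\<^esub> mu_cell X ?p f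
      = (?\<gamma>vu \<lhd>\<^bsub>D\<^esub> ?Gs) \<cdot>\<^bsub>D\<^esub> (psf_cell G (kappa Y v g) \<lhd>\<^bsub>D\<^esub> ?Gs) \<cdot>\<^bsub>D\<^esub> ?\<gamma>p \<cdot>\<^bsub>D\<^esub> psf_cell G (kappa X ?p f)"
    unfolding mu_cell_def by (simp flip: J.D.rwhisker_vcomp)
  also have "\<dots> = (?\<gamma>vu \<lhd>\<^bsub>D\<^esub> ?Gs) \<cdot>\<^bsub>D\<^esub> ?\<gamma>s \<cdot>\<^bsub>D\<^esub> psf_cell G (kappa Y v g \<lhd>\<^bsub>E\<^esub> ?s) \<cdot>\<^bsub>D\<^esub> psf_cell G (kappa X ?p f)"
    by (subst J.D.vcomp_eq_extend[OF r]) simp_all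
  finally show ?thesis
    unfolding L by simp
qed

text \<open>Once the inverse compositor has been moved to the left, \<open>inv_runit_P\<close> turns
  the right unitor of \<open>D\<close> into the image of that of \<open>E\<close>, and what remains
  is \<open>G\<close> applied to \<open>kappa_theta_cell\<close>.\<close>

lemma mu_cell_unit:
  assumes "X \<in> Obj C" "A \<in> Obj E" "f \<in> Mor D" "src D f = psf_obj J X" "trg D f = psf_obj G A"
  shows "runit D (psf_mor G (sharp X A f))
      \<cdot>\<^bsub>D\<^esub> (psf_mor G (sharp X A f) \<rhd>\<^bsub>D\<^esub> (inv2 D (psf_id G (rpa_obj F X)) \<cdot>\<^bsub>D\<^esub> psf_cell G (theta_cell X)))
      \<cdot>\<^bsub>D\<^esub> mu_cell X (sharp X A f) (rpa_i F X) \<cdot>\<^bsub>D\<^esub> psf_cell G (sharp2 X A (rpa_unit F X A f))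
    = id2 D (psf_mor G (sharp X A f))"
proof -
  let ?s = "sharp X A f" and ?o = "rpa_obj F X" and ?\<theta> = "theta_cell X"
    and ?\<iota> = "inv2 D (psf_id G (rpa_obj F X))"
  let ?Gs = "psf_mor G ?s" and ?\<kappa> = "kappa X ?s (rpa_i F X)" and ?\<eta> = "sharp2 X A (rpa_unit F X A f)"
  let ?\<gamma> = "inv2 D (psf_comp G ?s (sharp X ?o (rpa_i F X)))" and ?\<gamma>' = "inv2 D (psf_comp G ?s (id1 E ?o))"
  note [simp] = assms
  have l: "(?Gs \<rhd>\<^bsub>D\<^esub> psf_cell G ?\<theta>) \<cdot>\<^bsub>D\<^esub> ?\<gamma> = ?\<gamma>' \<cdot>\<^bsub>D\<^esub> psf_cell G (?s \<rhd>\<^bsub>E\<^esub> ?\<theta>)"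
    by (rule inv_comp_G_lwhisker) simp_all
  have "runit D ?Gs \<cdot>\<^bsub>D\<^esub> (?Gs \<rhd>\<^bsub>D\<^esub> (?\<iota> \<cdot>\<^bsub>D\<^esub> psf_cell G ?\<theta>)) \<cdot>\<^bsub>D\<^esub> mu_cell X ?s (rpa_i F X) \<cdot>\<^bsub>D\<^esub> psf_cell G ?\<eta>
      = runit D ?Gs \<cdot>\<^bsub>D\<^esub> (?Gs \<rhd>\<^bsub>D\<^esub> ?\<iota>) \<cdot>\<^bsub>D\<^esub> (?Gs \<rhd>\<^bsub>D\<^esub> psf_cell G ?\<theta>) \<cdot>\<^bsub>D\<^esub> ?\<gamma>
        \<cdot>\<^bsub>D\<^esub> psf_cell G ?\<kappa> \<cdot>\<^bsub>D\<^esub> psf_cell G ?\<eta>"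
    unfolding mu_cell_def by (simp flip: J.D.lwhisker_vcomp)
  also have "\<dots> = runit D ?Gs \<cdot>\<^bsub>D\<^esub> (?Gs \<rhd>\<^bsub>D\<^esub> ?\<iota>) \<cdot>\<^bsub>D\<^esub> ?\<gamma>' \<cdot>\<^bsub>D\<^esub> psf_cell G (?s \<rhd>\<^bsub>E\<^esub> ?\<theta>)
        \<cdot>\<^bsub>D\<^esub> psf_cell G ?\<kappa> \<cdot>\<^bsub>D\<^esub> psf_cell G ?\<eta>"
    by (subst J.D.vcomp_eq_extend[OF l]) simp_all
  also have "\<dots> = (runit D ?Gs \<cdot>\<^bsub>D\<^esub> (?Gs \<rhd>\<^bsub>D\<^esub> ?\<iota>) \<cdot>\<^bsub>D\<^esub> ?\<gamma>') \<cdot>\<^bsub>D\<^esub> psf_cell G (?s \<rhd>\<^bsub>E\<^esub> ?\<theta>)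
        \<cdot>\<^bsub>D\<^esub> psf_cell G ?\<kappa> \<cdot>\<^bsub>D\<^esub> psf_cell G ?\<eta>"
    by simp
  also have "runit D ?Gs \<cdot>\<^bsub>D\<^esub> (?Gs \<rhd>\<^bsub>D\<^esub> ?\<iota>) \<cdot>\<^bsub>D\<^esub> ?\<gamma>' = psf_cell G (runit E ?s)"
    by (rule G.inv_runit_P) simp_all
  also have "psf_cell G (runit E ?s) \<cdot>\<^bsub>D\<^esub> psf_cell G (?s \<rhd>\<^bsub>E\<^esub> ?\<theta>) \<cdot>\<^bsub>D\<^esub> psf_cell G ?\<kappa> \<cdot>\<^bsub>D\<^esub> psf_cell G ?\<eta>
      = psf_cell G (runit E ?s \<cdot>\<^bsub>E\<^esub> (?s \<rhd>\<^bsub>E\<^esub> ?\<theta>) \<cdot>\<^bsub>E\<^esub> ?\<kappa> \<cdot>\<^bsub>E\<^esub> ?\<eta>)"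
    by (simp flip: G.vcomp_P)
  also have "\<dots> = id2 D ?Gs"
    by (simp add: kappa_theta_cell)
  finally show ?thesis .
qed

section \<open>Assembly of the relative pseudomonad\<close>

definition induced_rpm :: "('oc, 'od, 'md, 'cd) rpm" where
  "induced_rpm =
    \<lparr>rpm_obj = (\<lambda>X. psf_obj G (rpa_obj F X)), rpm_i = rpa_i F,
     rpm_star = (\<lambda>X Y. comp_fctr \<lparr>on_ob = psf_mor G, on_ar = psf_cell G\<rparr> (rpa_sharp F X (rpa_obj F Y))),
     rpm_mu = (\<lambda>X Y Z g f. mu_cell X (sharp Y (rpa_obj F Z) g) f),
     rpm_eta = (\<lambda>X Y f. rpa_unit F X (rpa_obj F Y) f),
     rpm_theta = (\<lambda>X. inv2 D (psf_id G (rpa_obj F X)) \<cdot>\<^bsub>D\<^esub> psf_cell G (theta_cell X))\<rparr>"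

lemma induced_rpm_sel:
  "rpm_obj induced_rpm X = psf_obj G (rpa_obj F X)"
  "rpm_i induced_rpm X = rpa_i F X"
  "rpm_mu induced_rpm X Y Z g f = mu_cell X (sharp Y (rpa_obj F Z) g) f"
  "rpm_eta induced_rpm X Y f = rpa_unit F X (rpa_obj F Y) f"
  "rpm_theta induced_rpm X = inv2 D (psf_id G (rpa_obj F X)) \<cdot>\<^bsub>D\<^esub> psf_cell G (theta_cell X)"
  "ext1 induced_rpm X Y f = psf_mor G (sharp X (rpa_obj F Y) f)"
  "ext2 induced_rpm X Y \<alpha> = psf_cell G (sharp2 X (rpa_obj F Y) \<alpha>)"
  by (simp_all add: induced_rpm_def comp_fctr_def)

theorem induced_rpm: "relative_pseudomonad C D J induced_rpm"
proof (intro relative_pseudomonad.intro relative_pseudomonad_axioms.intro J.pseudofunctor_axioms,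
    unfold in_Mors in_Cells induced_rpm_sel, goal_cases)
  \<comment> \<open>The goals treated separately are functoriality of the extension, naturality of
    \<open>rpm_mu\<close> and of \<open>rpm_eta\<close>, and the two coherence axioms. The others
    concern boundaries and invertibility and follow from the simp rules.\<close>
  case (3 X Y)
  have "cat_functor (hom D (psf_obj J X) (psf_obj G (rpa_obj F Y)))
      (hom D (psf_obj G (rpa_obj F X)) (psf_obj G (rpa_obj F Y)))
      (comp_fctr \<lparr>on_ob = psf_mor G, on_ar = psf_cell G\<rparr> (rpa_sharp F X (rpa_obj F Y)))"
    using 3 by (intro comp_fctr_functor[OF sharp_functor] G.psf_hom) simp_all
  then show ?case
    by (simp add: induced_rpm_def)
next
  case (6 X Y Z f g \<alpha> f' \<beta> g')
  then show ?case
    \<comment> \<open>The 2-cell of \<open>E\<close> taken in \<open>mu_cell_nat\<close> is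
      \<open>sharp2 Y (rpa_obj F Z) \<beta>\<close>.\<close>
    by (elim conjE, intro mu_cell_nat) simp_all
next
  case (9 X Y f \<alpha> f')
  then show ?case
    by (elim conjE, intro unit_nat) simp_all
next
  case (12 X Y Z V f g h)
  then show ?case
    by (intro mu_cell_assoc) simp_all
next
  case (13 X Y f)
  then show ?case
    by (intro mu_cell_unit) simp_all
qed (simp_all)

end

theorem theorem3p8:
  fixes C :: "('oc, 'mc, 'cc) bicat" and D :: "('od, 'md, 'cd) bicat"
    and E :: "('oe, 'me, 'ce) bicat"
    and J :: "('oc, 'mc, 'cc, 'od, 'md, 'cd) psf"
    and G :: "('oe, 'me, 'ce, 'od, 'md, 'cd) psf"
    and F :: "('oc, 'md, 'cd, 'oe, 'me, 'ce) rpa"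
  assumes "bicategory C" and "bicategory D" and "bicategory E"
    and "pseudofunctor C D J" and "pseudofunctor E D G"
    and "relative_pseudoadjunction C D E J G F"
  shows "\<exists>T. relative_pseudomonad C D J T \<and>
             (\<forall>X \<in> Obj C. rpm_obj T X = psf_obj G (rpa_obj F X))"
  using relative_pseudoadjunction.induced_rpm[OF assms(6)]
    relative_pseudoadjunction.induced_rpm_sel(1)[OF assms(6)]
  by blast

end
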